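(* Let $R$ be an irreducible reduced root system, let $\kappa$ be any multiplicity parameter, and let $b^{\kappa}$, $a^{\kappa}$ and the product $\cdot_{\kappa}$ be as described in the context. Then the complex manifold $H^{\circ}\times\mathbb{C}^{\times}$ endowed with the structure $(\cdot_{\kappa},a^{\kappa},t\frac{\partial}{\partial t})$ (product, symmetric bilinear form, identity field) is a Frobenius manifold.
   Context: Frobenius algebra: a pair $(A,F)$ where $A$ is a commutative, associative, unital, finite-dimensional $\mathbb{C}$-algebra and $F:A\to\mathbb{C}$ is a trace map, i.e. a linear function such that $a(u,v):=F(uv)$ is a nondegenerate bilinear form. A nondegenerate symmetric bilinear form $a$ with $a(uv,w)=a(u,vw)$ determines the trace map $F(u)=a(u,e)$, $e$ the unit. Frobenius manifold (no Euler field is required): a complex manifold $M$ whose holomorphic tangent bundle is fiberwise endowed with the structure of a Frobenius algebra $(\cdot,F,e)$, depending holomorphically on the base point, such that, with $a(X,Y)=F(X\cdot Y)$, $T(X,Y,Z)=a(X\cdot Y,Z)$, and $\nabla$ the (holomorphic) Levi-Civita connection of $a$: (i) the following equivalent conditions hold: (1) $\nabla$ is flat, the product is associative, and locally there is a holomorphic function $\Phi$ with $T(X,Y,Z)=\nabla_X\nabla_Y\nabla_Z\Phi$ for all flat local vector fields $X,Y,Z$; (2) $\nabla$ is flat, the product is associative, and $[\nabla_X,\iota_Y]-[\nabla_Y,\iota_X]-\iota_{[X,Y]}=0$ for all local vector fields $X,Y$, where $\iota_X(Y)=X\cdot Y$; (3) the connection $\nabla(\mu)_XY:=\nabla_XY+\mu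 X\cdot Y$ is flat for every $\mu\in\mathbb{C}$; and (ii) the identity field $e$ is flat for $\nabla$. Root data: $\mathfrak{a}$ is a Euclidean space of dimension $n$, and $R\subset\mathfrak{a}^{*}$ is an irreducible reduced root system with Weyl group $W$, a fixed choice of positive roots ($\alpha>0$), root lattice $Q=\mathbb{Z}R$, and coroots $\alpha^{\vee}\in\mathfrak{a}$. $H=\mathrm{Hom}(Q,\mathbb{C}^{\times})$ is the algebraic torus with character lattice $Q$; its Lie algebra is $\mathfrak{h}=\mathbb{C}\otimes\mathrm{Hom}(Q,\mathbb{Z})=\mathbb{C}\otimes\mathfrak{a}$. Each root $\alpha$ gives a character $e^{\alpha}:H\to\mathbb{C}^{\times}$ and a hypertorus $H_{\alpha}=\{h\in H: e^{\alpha}(h)=1\}$; $H^{\circ}:=H-\bigcup_{\alpha>0}H_{\alpha}$. The coordinate on $\mathbb{C}^{\times}$ is $t$. By translation invariance $T_{(p,t)}(H^{\circ}\times\mathbb{C}^{\times})=\mathfrak{h}\oplus\mathbb{C}\,t\frac{\partial}{\partial t}$, and vector fields are written $\tilde X=X+\lambda_1t\frac{\partial}{\partial t}$ with $X$ in the $\mathfrak{h}$-direction and $\lambda_1$ a holomorphic function. Parameters: $\kappa=(k_{\alpha})_{\alpha\in R}\in\mathbb{C}^{R}$ is $W$-invariant ($k_{w\alpha}=k_{\alpha}$); for type $A_n$ an additional parameter $k'\in\mathbb{C}$ is included in $\kappa$. The $W$-equivariant symmetric bilinear map $b^{\kappa}:\mathfrak{h}\times\mathfrak{h}\to\mathfrak{h}$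 is $0$ unless $R$ is of type $A_n$ with $n\ge2$, in which case $$b^{\kappa}(u,v)=\tfrac12k'\sum_{\alpha>0}\alpha(u)\alpha(v)\alpha',$$ where $R$ is realized by $\alpha=z_i-z_j$ (positive for $1\le i<j\le n+1$) with $\{z_i\}$ the basis dual to the standard basis $\{\varepsilon_i\}$ of $\mathbb{R}^{n+1}$, $\mathfrak{h}$ is the sum-zero hyperplane of $\mathbb{C}^{n+1}$, and $\alpha'=\varepsilon_i+\varepsilon_j-\frac{2}{n+1}\sum_l\varepsilon_l$ for $\alpha=z_i-z_j$. Product: for $\tilde X=X+\lambda_1t\frac{\partial}{\partial t}$, $\tilde Y=Y+\lambda_2t\frac{\partial}{\partial t}$, $$\tilde X\cdot_{\kappa}\tilde Y:=\frac12\sum_{\alpha>0}k_{\alpha}\frac{1+e^{\alpha}}{1-e^{\alpha}}\,\alpha(X)\alpha(Y)\,\alpha^{\vee}-b^{\kappa}(X,Y)-a^{\kappa}(X,Y)\,t\frac{\partial}{\partial t}+\lambda_2X+\lambda_1Y+\lambda_1\lambda_2\,t\frac{\partial}{\partial t}.$$ The form $a^{\kappa}:\mathfrak{h}\times\mathfrak{h}\to\mathbb{C}$ is a $W$-invariant symmetric bilinear form, fixed such that the connection $$\tilde\nabla^{\kappa}_{\tilde X}\tilde Y=\tilde\nabla^{0}_{\tilde X}\tilde Y+\tilde X\cdot_{\kappa}\tilde Y$$ on $T(H^{\circ}\times\mathbb{C}^{\times})$ is flat, where $\tilde\nabla^{0}$ is the flat translation-invariant connection on $H\times\mathbb{C}^{\times}$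 (for which translation-invariant vector fields are flat). It is a known result that for every $\kappa$ such a form exists. The form $a^{\kappa}$ is extended to $\mathfrak{h}\oplus\mathbb{C}\,t\frac{\partial}{\partial t}$ (hence to a translation-invariant form on the tangent bundle) by $a^{\kappa}(X,t\frac{\partial}{\partial t})=0$ and $a^{\kappa}(t\frac{\partial}{\partial t},t\frac{\partial}{\partial t})=-1$.
   Formalization: The form a^κ on 𝔥 is additionally assumed not identically zero: for some κ (e.g. κ = 0, n ≥ 2) flatness forces a^κ = 0 on 𝔥, so the form is degenerate and the claim fails. *)

theory Defs
  imports "HOL-Analysis.Analysis"
begin

section \<open>Frobenius algebras\<close>

definition complex_linear_form :: "(complex^'m \<Rightarrow> complex) \<Rightarrow> bool" where
  "complex_linear_form f \<longleftrightarrow> Vector_Spaces.linear (*s) (*) f"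

definition complex_bilinear_form :: "(complex^'m \<Rightarrow> complex^'m \<Rightarrow> complex) \<Rightarrow> bool" where
  "complex_bilinear_form g \<longleftrightarrow>
     (\<forall>u. complex_linear_form (\<lambda>v. g u v)) \<and> (\<forall>v. complex_linear_form (\<lambda>u. g u v))"

definition complex_bilinear_map :: "(complex^'m \<Rightarrow> complex^'m \<Rightarrow> complex^'m) \<Rightarrow> bool" where
  "complex_bilinear_map B \<longleftrightarrow>
     (\<forall>u. Vector_Spaces.linear (*s) (*s) (\<lambda>v. B u v)) \<and>
     (\<forall>v. Vector_Spaces.linear (*s) (*s) (\<lambda>u. B u v))"

definition frobenius_algebra ::
  "(complex^'m \<Rightarrow> complex^'m \<Rightarrow> complex^'m) \<Rightarrow> (complex^'m \<Rightarrow> complex) \<Rightarrow> complex^'m \<Rightarrow> bool" where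
  "frobenius_algebra mul F e \<longleftrightarrow>
     complex_bilinear_map mul \<and>
     (\<forall>u v. mul u v = mul v u) \<and>
     (\<forall>u v w. mul (mul u v) w = mul u (mul v w)) \<and>
     (\<forall>u. mul e u = u) \<and>
     complex_linear_form F \<and>
     (\<forall>u. (\<forall>v. F (mul u v) = 0) \<longrightarrow> u = 0)"


section \<open>Holomorphic functions, vector fields and connections on open subsets of \<open>\<complex>\<^sup>m\<close>\<close>

definition holomorphic_fun_on :: "(complex^'m) set \<Rightarrow> (complex^'m \<Rightarrow> complex) \<Rightarrow> bool" where
  "holomorphic_fun_on S f \<longleftrightarrow>
     (\<forall>x\<in>S. \<exists>D. (f has_derivative D) (at x) \<and> complex_linear_form D)"

definition holomorphic_map_on :: "(complex^'m) set \<Rightarrow> (complex^'m \<Rightarrow> complex^'k) \<Rightarrow> bool" where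
  "holomorphic_map_on S f \<longleftrightarrow> (\<forall>i. holomorphic_fun_on S (\<lambda>x. f x $ i))"

definition lie_bracket ::
  "(complex^'m \<Rightarrow> complex^'m) \<Rightarrow> (complex^'m \<Rightarrow> complex^'m) \<Rightarrow> complex^'m \<Rightarrow> complex^'m" where
  "lie_bracket X Y x =
     frechet_derivative Y (at x) (X x) - frechet_derivative X (at x) (Y x)"

text \<open>A connection on the tangent bundle of an open set is given by its Christoffel map \<open>\<Gamma>\<close>,
  that is, \<open>\<Gamma> x u v\<close> is the value at \<open>x\<close> of the covariant derivative, in the direction \<open>u\<close>, of
  the constant vector field \<open>v\<close>.\<close>

definition covariant_derivative ::
  "(complex^'m \<Rightarrow> complex^'m \<Rightarrow> complex^'m \<Rightarrow> complex^'m) \<Rightarrow>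
   (complex^'m \<Rightarrow> complex^'m) \<Rightarrow> (complex^'m \<Rightarrow> complex^'m) \<Rightarrow> complex^'m \<Rightarrow> complex^'m" where
  "covariant_derivative \<Gamma> X Y x = frechet_derivative Y (at x) (X x) + \<Gamma> x (X x) (Y x)"

definition flat_connection_on ::
  "(complex^'m) set \<Rightarrow> (complex^'m \<Rightarrow> complex^'m \<Rightarrow> complex^'m \<Rightarrow> complex^'m) \<Rightarrow> bool" where
  "flat_connection_on \<Omega> \<Gamma> \<longleftrightarrow>
     (\<forall>V X Y Z. open V \<and> V \<subseteq> \<Omega> \<and>
        holomorphic_map_on V X \<and> holomorphic_map_on V Y \<and> holomorphic_map_on V Z \<longrightarrow>
        (\<forall>x\<in>V. covariant_derivative \<Gamma> X (covariant_derivative \<Gamma> Y Z) x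
              - covariant_derivative \<Gamma> Y (covariant_derivative \<Gamma> X Z) x
              - covariant_derivative \<Gamma> (lie_bracket X Y) Z x = 0))"

definition levi_civita_on ::
  "(complex^'m) set \<Rightarrow> (complex^'m \<Rightarrow> complex^'m \<Rightarrow> complex^'m \<Rightarrow> complex) \<Rightarrow>
   (complex^'m \<Rightarrow> complex^'m \<Rightarrow> complex^'m \<Rightarrow> complex^'m) \<Rightarrow> bool" where
  "levi_civita_on \<Omega> g \<Gamma> \<longleftrightarrow>
     (\<forall>x\<in>\<Omega>. complex_bilinear_map (\<Gamma> x)) \<and>
     (\<forall>u v. holomorphic_map_on \<Omega> (\<lambda>x. \<Gamma> x u v)) \<and>
     (\<forall>V X Y Z. open V \<and> V \<subseteq> \<Omega> \<and>
        holomorphic_map_on V X \<and> holomorphic_map_on V Y \<and> holomorphic_map_on V Z \<longrightarrow>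
        (\<forall>x\<in>V.
           covariant_derivative \<Gamma> X Y x - covariant_derivative \<Gamma> Y X x = lie_bracket X Y x \<and>
           frechet_derivative (\<lambda>y. g y (Y y) (Z y)) (at x) (X x) =
             g x (covariant_derivative \<Gamma> X Y x) (Z x) +
             g x (Y x) (covariant_derivative \<Gamma> X Z x)))"


section \<open>Frobenius manifolds\<close>

text \<open>The form \<open>g\<close> and the trace map determine each other: the trace map is \<open>\<lambda>u. g u e\<close>, and
  \<open>g\<close> is required to be the form \<open>(u, v) \<mapsto> F (u \<cdot> v)\<close> of that trace map.  The condition linking the
  product to the Levi-Civita connection is flatness of the whole pencil \<open>\<nabla> + \<mu> (\<cdot>)\<close>.\<close>

definition frobenius_structure_on ::
  "(complex^'m) set \<Rightarrow> (complex^'m \<Rightarrow> complex^'m \<Rightarrow> complex^'m \<Rightarrow> complex^'m) \<Rightarrow>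
   (complex^'m \<Rightarrow> complex^'m \<Rightarrow> complex^'m \<Rightarrow> complex) \<Rightarrow> (complex^'m \<Rightarrow> complex^'m) \<Rightarrow> bool" where
  "frobenius_structure_on \<Omega> mul g e \<longleftrightarrow>
     (\<forall>x\<in>\<Omega>. frobenius_algebra (mul x) (\<lambda>u. g x u (e x)) (e x) \<and>
             (\<forall>u v. g x u v = g x (mul x u v) (e x))) \<and>
     (\<forall>u v. holomorphic_map_on \<Omega> (\<lambda>x. mul x u v)) \<and>
     (\<forall>u v. holomorphic_fun_on \<Omega> (\<lambda>x. g x u v)) \<and>
     holomorphic_map_on \<Omega> e \<and>
     (\<exists>\<Gamma>. levi_civita_on \<Omega> g \<Gamma> \<and>
          (\<forall>\<mu>. flat_connection_on \<Omega> (\<lambda>x u v. \<Gamma> x u v + \<mu> *s mul x u v)) \<and>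
          (\<forall>V X. open V \<and> V \<subseteq> \<Omega> \<and> holomorphic_map_on V X \<longrightarrow>
             (\<forall>x\<in>V. covariant_derivative \<Gamma> X e x = 0)))"

text \<open>A chart is a pair of its domain and its coordinate map.\<close>

type_synonym ('p, 'm) chart = "'p set \<times> ('p \<Rightarrow> complex^'m)"

definition chart_inv :: "('p, 'm) chart \<Rightarrow> complex^'m \<Rightarrow> 'p" where
  "chart_inv c = inv_into (fst c) (snd c)"

definition chart_image :: "('p, 'm::finite) chart \<Rightarrow> (complex^'m) set" where
  "chart_image c = snd c ` fst c"

definition complex_manifold :: "'p topology \<Rightarrow> ('p, 'm::finite) chart set \<Rightarrow> bool" where
  "complex_manifold T A \<longleftrightarrow>
     Hausdorff_space T \<and>
     (\<exists>\<B>. countable \<B> \<and> (\<forall>B\<in>\<B>. openin T B) \<and>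
          (\<forall>U p. openin T U \<and> p \<in> U \<longrightarrow> (\<exists>B\<in>\<B>. p \<in> B \<and> B \<subseteq> U))) \<and>
     (\<Union>c\<in>A. fst c) = topspace T \<and>
     (\<forall>c\<in>A. openin T (fst c) \<and> open (chart_image c) \<and>
        homeomorphic_map (subtopology T (fst c)) (top_of_set (chart_image c)) (snd c)) \<and>
     (\<forall>c\<in>A. \<forall>d\<in>A. holomorphic_map_on (snd c ` (fst c \<inter> fst d)) (snd d \<circ> chart_inv c))"

text \<open>Tensor fields on a manifold are given by their coordinate expressions: \<open>mul c p\<close> is the
  product on the tangent space at \<open>p\<close> in the coordinates of the chart \<open>c\<close>, and likewise for \<open>g\<close>
  and \<open>e\<close>.  These expressions have to match under the derivatives of the transition maps.\<close>

definition frobenius_manifold ::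
  "'p topology \<Rightarrow> ('p, 'm::finite) chart set \<Rightarrow>
   (('p, 'm) chart \<Rightarrow> 'p \<Rightarrow> complex^'m \<Rightarrow> complex^'m \<Rightarrow> complex^'m) \<Rightarrow>
   (('p, 'm) chart \<Rightarrow> 'p \<Rightarrow> complex^'m \<Rightarrow> complex^'m \<Rightarrow> complex) \<Rightarrow>
   (('p, 'm) chart \<Rightarrow> 'p \<Rightarrow> complex^'m) \<Rightarrow> bool" where
  "frobenius_manifold T A mul g e \<longleftrightarrow>
     complex_manifold T A \<and>
     (\<forall>c\<in>A. \<forall>d\<in>A. \<forall>p \<in> fst c \<inter> fst d.
        let D = frechet_derivative (snd d \<circ> chart_inv c) (at (snd c p)) in
          (\<forall>u v. D (mul c p u v) = mul d p (D u) (D v)) \<and>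
          (\<forall>u v. g c p u v = g d p (D u) (D v)) \<and>
          D (e c p) = e d p) \<and>
     (\<forall>c\<in>A. frobenius_structure_on (chart_image c)
        (\<lambda>x. mul c (chart_inv c x)) (\<lambda>x. g c (chart_inv c x)) (\<lambda>x. e c (chart_inv c x)))"


section \<open>Root systems\<close>

text \<open>The Euclidean space is \<open>real^'n\<close>; roots are elements of its dual.\<close>

type_synonym 'n covector = "(real^'n, real) blinfun"

definition coroot :: "'n::finite covector \<Rightarrow> real^'n" where
  "coroot \<alpha> =
     (let r = (\<chi> i. blinfun_apply \<alpha> (axis i 1)) in (2 / (r \<bullet> r)) *\<^sub>R r)"

definition root_system :: "'n::finite covector set \<Rightarrow> bool" where
  "root_system R \<longleftrightarrow>
     finite R \<and> span R = UNIV \<and> 0 \<notin> R \<and>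
     (\<forall>\<alpha>\<in>R. \<forall>\<beta>\<in>R. \<beta> - blinfun_apply \<beta> (coroot \<alpha>) *\<^sub>R \<alpha> \<in> R) \<and>
     (\<forall>\<alpha>\<in>R. \<forall>\<beta>\<in>R. blinfun_apply \<beta> (coroot \<alpha>) \<in> \<int>)"

definition reduced_root_system :: "'n::finite covector set \<Rightarrow> bool" where
  "reduced_root_system R \<longleftrightarrow> (\<forall>\<alpha>\<in>R. \<forall>c. c *\<^sub>R \<alpha> \<in> R \<longrightarrow> c = 1 \<or> c = -1)"

definition irreducible_root_system :: "'n::finite covector set \<Rightarrow> bool" where
  "irreducible_root_system R \<longleftrightarrow>
     R \<noteq> {} \<and>
     \<not> (\<exists>R1 R2. R1 \<noteq> {} \<and> R2 \<noteq> {} \<and> R1 \<inter> R2 = {} \<and> R1 \<union> R2 = R \<and>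
          (\<forall>\<alpha>\<in>R1. \<forall>\<beta>\<in>R2. blinfun_apply \<beta> (coroot \<alpha>) = 0))"

definition positive_roots :: "'n::finite covector set \<Rightarrow> 'n covector set \<Rightarrow> bool" where
  "positive_roots R P \<longleftrightarrow>
     (\<exists>v. (\<forall>\<alpha>\<in>R. blinfun_apply \<alpha> v \<noteq> 0) \<and> P = {\<alpha>\<in>R. blinfun_apply \<alpha> v > 0})"

definition reflection :: "'n::finite covector \<Rightarrow> real^'n \<Rightarrow> real^'n" where
  "reflection \<alpha> v = v - blinfun_apply \<alpha> v *\<^sub>R coroot \<alpha>"

inductive_set weyl_group :: "'n::finite covector set \<Rightarrow> (real^'n \<Rightarrow> real^'n) set"
  for R :: "'n covector set" where
  weyl_id: "id \<in> weyl_group R"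
| weyl_reflection: "\<alpha> \<in> R \<Longrightarrow> w \<in> weyl_group R \<Longrightarrow> reflection \<alpha> \<circ> w \<in> weyl_group R"

definition weyl_act_dual :: "(real^'n \<Rightarrow> real^'n) \<Rightarrow> 'n::finite covector \<Rightarrow> 'n covector" where
  "weyl_act_dual w \<alpha> = Blinfun (\<lambda>v. blinfun_apply \<alpha> (inv w v))"

definition weyl_invariant_multiplicity ::
  "'n::finite covector set \<Rightarrow> ('n covector \<Rightarrow> complex) \<Rightarrow> bool" where
  "weyl_invariant_multiplicity R k \<longleftrightarrow>
     (\<forall>w\<in>weyl_group R. \<forall>\<alpha>\<in>R. k (weyl_act_dual w \<alpha>) = k \<alpha>)"


section \<open>Complexification\<close>

definition re_vec :: "complex^'n \<Rightarrow> real^'n" where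
  "re_vec z = (\<chi> i. Re (z $ i))"

definition im_vec :: "complex^'n \<Rightarrow> real^'n" where
  "im_vec z = (\<chi> i. Im (z $ i))"

definition cvec :: "real^'n \<Rightarrow> complex^'n" where
  "cvec v = (\<chi> i. complex_of_real (v $ i))"

definition cform :: "'n::finite covector \<Rightarrow> complex^'n \<Rightarrow> complex" where
  "cform \<alpha> z = Complex (blinfun_apply \<alpha> (re_vec z)) (blinfun_apply \<alpha> (im_vec z))"

definition cmap :: "(real^'n \<Rightarrow> real^'n) \<Rightarrow> complex^'n \<Rightarrow> complex^'n" where
  "cmap w z = cvec (w (re_vec z)) + \<i> *s cvec (w (im_vec z))"


section \<open>The bilinear map \<open>b\<^sup>\<kappa>\<close>\<close>

text \<open>A realization of \<open>R\<close> as a root system of type \<open>A\<^sub>n\<close> is a linear isomorphism \<open>\<phi>\<close> onto the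
  sum-zero hyperplane, with coordinates indexed by \<open>{1..n + 1}\<close>; the coordinate function \<open>z\<^sub>i\<close> is
  \<open>\<lambda>v. \<phi> v i\<close>.\<close>

definition sum_zero_hyperplane :: "nat \<Rightarrow> (nat \<Rightarrow> real) set" where
  "sum_zero_hyperplane N = {x. (\<forall>i. i \<notin> {1..N} \<longrightarrow> x i = 0) \<and> (\<Sum>i=1..N. x i) = 0}"

definition typeA_root :: "(real^'n::finite \<Rightarrow> nat \<Rightarrow> real) \<Rightarrow> nat \<Rightarrow> nat \<Rightarrow> 'n covector" where
  "typeA_root \<phi> i j = Blinfun (\<lambda>v. \<phi> v i - \<phi> v j)"

definition typeA_realization ::
  "'n::finite covector set \<Rightarrow> (real^'n \<Rightarrow> nat \<Rightarrow> real) \<Rightarrow> bool" where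
  "typeA_realization R \<phi> \<longleftrightarrow>
     (\<forall>i. linear (\<lambda>v. \<phi> v i)) \<and>
     bij_betw \<phi> UNIV (sum_zero_hyperplane (CARD('n) + 1)) \<and>
     R = {typeA_root \<phi> i j | i j. i \<in> {1..CARD('n) + 1} \<and> j \<in> {1..CARD('n) + 1} \<and> i \<noteq> j}"

definition typeA :: "'n::finite covector set \<Rightarrow> bool" where
  "typeA R \<longleftrightarrow> (\<exists>\<phi>. typeA_realization R \<phi>)"

definition typeA_positive :: "'n::finite covector set \<Rightarrow> (real^'n \<Rightarrow> nat \<Rightarrow> real) \<Rightarrow> bool" where
  "typeA_positive P \<phi> \<longleftrightarrow> P = {typeA_root \<phi> i j | i j. 1 \<le> i \<and> i < j \<and> j \<le> CARD('n) + 1}"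

definition typeA_prime :: "(real^'n::finite \<Rightarrow> nat \<Rightarrow> real) \<Rightarrow> nat \<Rightarrow> nat \<Rightarrow> real^'n" where
  "typeA_prime \<phi> i j =
     inv \<phi> (\<lambda>l. if l \<in> {1..CARD('n) + 1}
                 then of_bool (l = i) + of_bool (l = j) - 2 / real (CARD('n) + 1) else 0)"

definition b_kappa ::
  "'n::finite covector set \<Rightarrow> (real^'n \<Rightarrow> nat \<Rightarrow> real) \<Rightarrow> complex \<Rightarrow>
   complex^'n \<Rightarrow> complex^'n \<Rightarrow> complex^'n" where
  "b_kappa R \<phi> k' u v =
     (if typeA R \<and> CARD('n) \<ge> 2
      then (k' / 2) *s (\<Sum>(i, j) \<in> {(i, j). 1 \<le> i \<and> i < j \<and> j \<le> CARD('n) + 1}.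
             (cform (typeA_root \<phi> i j) u * cform (typeA_root \<phi> i j) v)
               *s cvec (typeA_prime \<phi> i j))
      else 0)"


section \<open>The complement of the toric arrangement as a complex manifold\<close>

definition root_lattice :: "'n::finite covector set \<Rightarrow> 'n covector set" where
  "root_lattice R = {(\<Sum>\<alpha>\<in>R. of_int (m \<alpha>) *\<^sub>R \<alpha>) | m :: 'n covector \<Rightarrow> int. True}"

text \<open>Points of the torus are group homomorphisms from the root lattice to \<open>\<complex>\<^sup>\<times>\<close>, so that the character
  \<open>e\<^sup>\<alpha>\<close> is \<open>\<lambda>h. h \<alpha>\<close>.  The torus carries the topology of pointwise convergence, which is the one
  inherited from the function space.\<close>

definition torus :: "'n::finite covector set \<Rightarrow> ('n covector \<Rightarrow> complex) set" where
  "torus R = {h \<in> extensional (root_lattice R).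
     (\<forall>q\<in>root_lattice R. h q \<noteq> 0) \<and>
     (\<forall>p\<in>root_lattice R. \<forall>q\<in>root_lattice R. h (p + q) = h p * h q)}"

definition torus_regular ::
  "'n::finite covector set \<Rightarrow> 'n covector set \<Rightarrow> ('n covector \<Rightarrow> complex) set" where
  "torus_regular R P = torus R - (\<Union>\<alpha>\<in>P. {h \<in> torus R. h \<alpha> = 1})"

type_synonym 'n toric_point = "('n covector \<Rightarrow> complex) \<times> complex"

definition toric_space :: "'n::finite covector set \<Rightarrow> 'n covector set \<Rightarrow> 'n toric_point set" where
  "toric_space R P = torus_regular R P \<times> (UNIV - {0})"

text \<open>The model space \<open>\<hh> \<oplus> \<complex>\<close> is \<open>complex^('n option)\<close>, whose \<open>None\<close> component is the coefficient
  of \<open>t \<partial>/\<partial>t\<close>.\<close>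

definition h_part :: "complex^('n::finite option) \<Rightarrow> complex^'n" where
  "h_part u = (\<chi> i. u $ Some i)"

definition t_part :: "complex^('n::finite option) \<Rightarrow> complex" where
  "t_part u = u $ None"

definition join_ht :: "complex^'n::finite \<Rightarrow> complex \<Rightarrow> complex^('n option)" where
  "join_ht X c = (\<chi> i. case i of None \<Rightarrow> c | Some j \<Rightarrow> X $ j)"

text \<open>The charts are the local inverses of \<open>(X, s) \<mapsto> (h\<^sub>0 exp X, t\<^sub>0 exp s)\<close>.  In each of them the
  coordinate vector fields are translation-invariant, the one of the last coordinate being
  \<open>t \<partial>/\<partial>t\<close>.  Hence the coordinates of a tangent vector are its components in \<open>\<hh> \<oplus> \<complex> t \<partial>/\<partial>t\<close>,
  whatever the chart, and the translation-invariant connection has Christoffel map \<open>0\<close>.\<close>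

definition toric_param ::
  "'n::finite covector set \<Rightarrow> 'n toric_point \<Rightarrow> complex^('n option) \<Rightarrow> 'n toric_point" where
  "toric_param R p x =
     ((\<lambda>q\<in>root_lattice R. fst p q * exp (cform q (h_part x))), snd p * exp (t_part x))"

definition toric_atlas ::
  "'n::finite covector set \<Rightarrow> 'n covector set \<Rightarrow> ('n toric_point, 'n option) chart set" where
  "toric_atlas R P =
     {(toric_param R p ` U, inv_into U (toric_param R p)) | p U.
        p \<in> toric_space R P \<and> open U \<and> inj_on (toric_param R p) U \<and>
        toric_param R p ` U \<subseteq> toric_space R P}"


section \<open>The structure on the toric arrangement complement\<close>

definition toric_mult ::
  "'n::finite covector set \<Rightarrow> ('n covector \<Rightarrow> complex) \<Rightarrow>
   (complex^'n \<Rightarrow> complex^'n \<Rightarrow> complex^'n) \<Rightarrow> (complex^'n \<Rightarrow> complex^'n \<Rightarrow> complex) \<Rightarrow>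
   'n toric_point \<Rightarrow> complex^('n option) \<Rightarrow> complex^('n option) \<Rightarrow> complex^('n option)" where
  "toric_mult P k b a p u v =
     (let h = fst p; X = h_part u; Y = h_part v; c1 = t_part u; c2 = t_part v in
      join_ht
        ((1 / 2) *s (\<Sum>\<alpha>\<in>P. (k \<alpha> * ((1 + h \<alpha>) / (1 - h \<alpha>)) * cform \<alpha> X * cform \<alpha> Y)
                           *s cvec (coroot \<alpha>))
         - b X Y + c2 *s X + c1 *s Y)
        (- a X Y + c1 * c2))"

definition toric_form ::
  "(complex^'n::finite \<Rightarrow> complex^'n \<Rightarrow> complex) \<Rightarrow> complex^('n option) \<Rightarrow> complex^('n option) \<Rightarrow> complex" where
  "toric_form a u v = a (h_part u) (h_part v) - t_part u * t_part v"

definition toric_unit :: "complex^('n::finite option)" where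
  "toric_unit = join_ht 0 1"

text \<open>The connection \<open>\<nabla>\<^sup>0 + (\<cdot>)\<close> has the product itself as Christoffel map, since that of \<open>\<nabla>\<^sup>0\<close> is \<open>0\<close>.\<close>

definition toric_connection_flat ::
  "'n::finite covector set \<Rightarrow> 'n covector set \<Rightarrow> ('n covector \<Rightarrow> complex) \<Rightarrow>
   (complex^'n \<Rightarrow> complex^'n \<Rightarrow> complex^'n) \<Rightarrow> (complex^'n \<Rightarrow> complex^'n \<Rightarrow> complex) \<Rightarrow> bool" where
  "toric_connection_flat R P k b a \<longleftrightarrow>
     (\<forall>c\<in>toric_atlas R P.
        flat_connection_on (chart_image c) (\<lambda>x. toric_mult P k b a (chart_inv c x)))"

text \<open>The form may vanish: if \<open>n \<ge> 2\<close>, \<open>k = 0\<close> and \<open>b = 0\<close>, then flatness forces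
  \<open>a X Y *s Z = a Y Z *s X\<close> for all \<open>X\<close>, \<open>Y\<close>, \<open>Z\<close>, hence \<open>a = 0\<close>, and there is no Frobenius algebra.\<close>

definition a_kappa_form ::
  "'n::finite covector set \<Rightarrow> 'n covector set \<Rightarrow> ('n covector \<Rightarrow> complex) \<Rightarrow>
   (complex^'n \<Rightarrow> complex^'n \<Rightarrow> complex^'n) \<Rightarrow> (complex^'n \<Rightarrow> complex^'n \<Rightarrow> complex) \<Rightarrow> bool" where
  "a_kappa_form R P k b a \<longleftrightarrow>
     complex_bilinear_form a \<and>
     (\<forall>u v. a u v = a v u) \<and>
     (\<forall>w\<in>weyl_group R. \<forall>u v. a (cmap w u) (cmap w v) = a u v) \<and>
     toric_connection_flat R P k b a"

end

(* A pencil nabla^0 + mu (.) over a translation-invariant connection with commutative product has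
   curvature mu (d-part) + mu^2 (commutator part). Here the d-part vanishes identically, because the
   derivative of (1 + e^alpha) / (1 - e^alpha) in the direction u is a multiple of alpha(u), so that
   the derivative of v.w along u is symmetric in u, v and w. Flatness at mu = 1, by which a^kappa is
   chosen, is therefore associativity, and conversely associativity makes the whole pencil flat.
   Since R is irreducible, a W-invariant form is a multiple of the Euclidean one, hence
   nondegenerate unless it vanishes. Its Levi-Civita connection is nabla^0, for which t d/dt is flat. *)

theory Submission
  imports Defs "HOL-Complex_Analysis.Cauchy_Integral_Formula"
begin

section \<open>Holomorphic functions of several variables and flat connections\<close>

text \<open>Holomorphy here means no more than complex differentiability at every point, while
  flatness is tested on arbitrary holomorphic fields over arbitrary open subsets. The curvature thus
  contains second derivatives of such a field, whose existence and symmetry have to be drawn from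
  Cauchy's formula on complex lines before any algebra can start. The other obstacle is the torus,
  whose points are homomorphisms on the root lattice under pointwise convergence. That exponential
  parametrizations are open onto it requires logarithms that are additive, and principal values are
  so only up to multiples of 2 pi i. Instead of a basis of the lattice all roots are used at once:
  the sum of \<gamma>(u) \<open>coroot \<gamma>\<close> over the roots is an invariant operator in
  u, by irreducibility the scalar 2|R|/n, with n the rank. It recovers u from the values
  \<gamma>(u), and applying a root to it gives an integral relation among the roots that controls
  the logarithms. Transition maps between exponential charts are local translations, so components
  of tensors agree in all charts.\<close>

lemma clinear_map_iff:
  fixes f :: "complex^'m \<Rightarrow> complex^'k"
  shows "Vector_Spaces.linear (*s) (*s) f \<longleftrightarrow>
    (\<forall>x y. f (x + y) = f x + f y) \<and> (\<forall>c x. f (c *s x) = c *s f x)"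
  by (auto simp: Vector_Spaces.linear_def module_hom_iff vec.module_axioms vec.vector_space_axioms)

lemma complex_linear_form_iff:
  fixes f :: "complex^'m \<Rightarrow> complex"
  shows "complex_linear_form f \<longleftrightarrow>
    (\<forall>x y. f (x + y) = f x + f y) \<and> (\<forall>c x. f (c *s x) = c * f x)"
proof -
  have "vector_space ((*) :: complex \<Rightarrow> complex \<Rightarrow> complex)" "module ((*) :: complex \<Rightarrow> complex \<Rightarrow> complex)"
    by (unfold_locales; simp add: algebra_simps)+
  then show ?thesis
    by (auto simp: complex_linear_form_def Vector_Spaces.linear_def module_hom_iff vec.module_axioms vec.vector_space_axioms)
qed

lemma clinear_map_nth_iff:
  fixes f :: "complex^'m \<Rightarrow> complex^'k"
  shows "Vector_Spaces.linear (*s) (*s) f \<longleftrightarrow> (\<forall>i. complex_linear_form (\<lambda>x. f x $ i))"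
  unfolding clinear_map_iff complex_linear_form_iff by (auto simp: vec_eq_iff)

lemma vec_expansion_axis: "(v::complex^'m) = (\<Sum>i\<in>UNIV. v $ i *s axis i 1)"
  by (simp add: basis_expansion)

lemma complex_linear_form_expansion:
  fixes f :: "complex^'m \<Rightarrow> complex"
  assumes "complex_linear_form f"
  shows "f v = (\<Sum>i\<in>UNIV. v $ i * f (axis i 1))"
proof -
  have add: "f (x + y) = f x + f y" and mul: "f (c *s x) = c * f x" for x y c
    using assms by (auto simp: complex_linear_form_iff)
  have f0: "f 0 = 0" using mul[of 0 0] by simp
  have "f (\<Sum>i\<in>A. g i) = (\<Sum>i\<in>A. f (g i))" for A and g :: "'m \<Rightarrow> complex^'m"
    by (induction A rule: infinite_finite_induct) (auto simp: add f0)
  then have "f (\<Sum>i\<in>UNIV. v $ i *s axis i 1) = (\<Sum>i\<in>UNIV. v $ i * f (axis i 1))"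
    by (simp add: mul)
  then show ?thesis by (simp only: vec_expansion_axis[symmetric])
qed

lemma norm_smult_vec: "norm (z *s (v::complex^'m)) = norm z * norm v"
  by (simp add: norm_vec_def L2_set_def norm_mult power_mult_distrib sum_distrib_left[symmetric] real_sqrt_mult)

lemma bounded_linear_smult_right: "bounded_linear (\<lambda>z. z *s (v::complex^'m))"
  by (rule bounded_linear_intro[where K = "norm v"])
     (auto simp: algebra_simps norm_smult_vec vec_eq_iff)

lemma bounded_bilinear_smult_vec: "bounded_bilinear (\<lambda>z (v::complex^'m). z *s v)"
  by (rule bounded_bilinear.intro)
     (auto simp: algebra_simps norm_smult_vec vec_eq_iff intro!: exI[of _ 1])

lemma scaleR_eq_smult: "r *\<^sub>R (v::complex^'m) = of_real r *s v"
  by (simp add: vec_eq_iff scaleR_conv_of_real[symmetric])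

lemma complex_linear_form_bounded_linear:
  fixes f :: "complex^'m \<Rightarrow> complex"
  assumes "complex_linear_form f"
  shows "bounded_linear f"
  using assms unfolding linear_conv_bounded_linear[symmetric] complex_linear_form_iff
  by (auto intro!: linearI simp: scaleR_eq_smult scaleR_conv_of_real)

lemma clinear_map_bounded_linear:
  fixes f :: "complex^'m \<Rightarrow> complex^'k"
  assumes "Vector_Spaces.linear (*s) (*s) f"
  shows "bounded_linear f"
  using assms unfolding linear_conv_bounded_linear[symmetric] clinear_map_iff
  by (auto intro!: linearI simp: scaleR_eq_smult)

lemma has_derivative_vec_iff:
  fixes f :: "'a::euclidean_space \<Rightarrow> complex^'k"
  shows "(f has_derivative D) (at x) \<longleftrightarrow> (\<forall>i. ((\<lambda>y. f y $ i) has_derivative (\<lambda>u. D u $ i)) (at x))"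
proof
  assume "\<forall>i. ((\<lambda>y. f y $ i) has_derivative (\<lambda>u. D u $ i)) (at x)"
  then have "((\<lambda>y. \<Sum>i\<in>UNIV. (f y $ i) *s axis i 1) has_derivative
      (\<lambda>u. \<Sum>i\<in>UNIV. (D u $ i) *s (axis i 1 :: complex^'k))) (at x)"
    by (intro has_derivative_sum bounded_linear.has_derivative[OF bounded_linear_smult_right]) auto
  then show "(f has_derivative D) (at x)"
    by (simp only: vec_expansion_axis[symmetric])
qed (auto intro: bounded_linear.has_derivative[OF bounded_linear_vec_nth])

section \<open>Derivatives of holomorphic functions and maps\<close>

lemma holomorphic_fun_on_frechet:
  assumes "holomorphic_fun_on S f" "x \<in> S"
  shows "(f has_derivative frechet_derivative f (at x)) (at x)"
    and "complex_linear_form (frechet_derivative f (at x))"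
proof -
  obtain D where D: "(f has_derivative D) (at x)" "complex_linear_form D"
    using assms by (auto simp: holomorphic_fun_on_def)
  then have "D = frechet_derivative f (at x)" by (rule_tac frechet_derivative_at)
  with D show "(f has_derivative frechet_derivative f (at x)) (at x)"
    "complex_linear_form (frechet_derivative f (at x))" by auto
qed

lemma holomorphic_fun_on_const: "holomorphic_fun_on S (\<lambda>x. c)"
proof -
  have "complex_linear_form (\<lambda>x. 0)" by (simp add: complex_linear_form_iff)
  then show ?thesis
    unfolding holomorphic_fun_on_def by (auto intro!: exI[of _ "\<lambda>x. 0"])
qed

lemma holomorphic_map_on_const: "holomorphic_map_on S (\<lambda>x. v)"
  by (simp add: holomorphic_map_on_def holomorphic_fun_on_const)

lemma holomorphic_map_on_frechet:
  fixes f :: "complex^'m \<Rightarrow> complex^'k"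
  assumes "holomorphic_map_on S f" "x \<in> S"
  shows "(f has_derivative frechet_derivative f (at x)) (at x)"
    and "Vector_Spaces.linear (*s) (*s) (frechet_derivative f (at x))"
    and "frechet_derivative f (at x) v $ i = frechet_derivative (\<lambda>x. f x $ i) (at x) v"
proof -
  define D where "D u = (\<chi> i. frechet_derivative (\<lambda>x. f x $ i) (at x) u)" for u
  have h: "holomorphic_fun_on S (\<lambda>x. f x $ i)" for i
    using assms by (auto simp: holomorphic_map_on_def)
  have "(f has_derivative D) (at x)"
    unfolding has_derivative_vec_iff D_def using holomorphic_fun_on_frechet(1)[OF h assms(2)] by simp
  then have eq: "frechet_derivative f (at x) = D" and "(f has_derivative frechet_derivative f (at x)) (at x)"
    using frechet_derivative_at by fastforce+
  then show "(f has_derivative frechet_derivative f (at x)) (at x)"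
    "frechet_derivative f (at x) v $ i = frechet_derivative (\<lambda>x. f x $ i) (at x) v"
    by (auto simp: D_def)
  show "Vector_Spaces.linear (*s) (*s) (frechet_derivative f (at x))"
    unfolding eq clinear_map_nth_iff D_def using holomorphic_fun_on_frechet(2)[OF h assms(2)] by simp
qed

lemma holomorphic_fun_on_imp_continuous_on:
  "holomorphic_fun_on S f \<Longrightarrow> continuous_on S f"
  by (meson continuous_at_imp_continuous_on has_derivative_continuous holomorphic_fun_on_frechet(1))

section \<open>Cauchy's formula on complex lines and second derivatives\<close>

text \<open>The circle is parametrised by \<open>circlepath 0 r\<close>, so that the factor \<open>2 \<pi> \<i>\<close> of Cauchy's formula
  cancels.\<close>

lemma frechet_derivative_circle_integral:
  fixes f :: "complex^'m \<Rightarrow> complex"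
  assumes f: "holomorphic_fun_on S f" and r: "r > 0"
    and S: "\<And>z. norm z \<le> r \<Longrightarrow> x + z *s v \<in> S"
  shows "frechet_derivative f (at x) v =
    integral {0..1} (\<lambda>t. f (x + circlepath 0 r t *s v) / circlepath 0 r t)"
proof -
  define F where "F z = f (x + z *s v)" for z
  have der: "(F has_field_derivative frechet_derivative f (at (x + z *s v)) v) (at z)" if "norm z \<le> r" for z
  proof -
    have 1: "((\<lambda>z. x + z *s v) has_derivative (\<lambda>h. h *s v)) (at z)"
      by (auto intro!: derivative_eq_intros bounded_linear.has_derivative[OF bounded_linear_smult_right])
    have "(F has_derivative (\<lambda>h. frechet_derivative f (at (x + z *s v)) (h *s v))) (at z)"
      unfolding F_def using diff_chain_at[OF 1 holomorphic_fun_on_frechet(1)[OF f S[OF that]]]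
      by (simp add: o_def)
    moreover have "frechet_derivative f (at (x + z *s v)) (h *s v) = frechet_derivative f (at (x + z *s v)) v * h" for h
      using holomorphic_fun_on_frechet(2)[OF f S[OF that]] by (simp add: complex_linear_form_iff)
    ultimately show ?thesis by (simp add: has_field_derivative_def)
  qed
  have cont: "continuous_on (cball 0 r) F"
    by (auto intro!: continuous_at_imp_continuous_on DERIV_isCont der)
  have hol: "F holomorphic_on ball 0 r"
    unfolding holomorphic_on_open[OF open_ball] using der by force
  have "((\<lambda>u. F u / (u - 0) ^ (Suc 1)) has_contour_integral ((2 * pi * \<i>) / (fact 1) * (deriv ^^ 1) F 0)) (circlepath 0 r)"
    by (rule Cauchy_has_contour_integral_higher_derivative_circlepath[OF cont hol]) (use r in auto)
  moreover have "deriv F 0 = frechet_derivative f (at x) v"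
    using der[of 0] r by (auto intro!: DERIV_imp_deriv)
  ultimately have "((\<lambda>t. F (circlepath 0 r t) / (circlepath 0 r t)^2 * (2 * pi * \<i> * r * exp (2 * pi * \<i> * t)))
      has_integral (2 * pi * \<i>) * frechet_derivative f (at x) v) {0..1}"
    by (simp add: has_contour_integral vector_derivative_circlepath power2_eq_square)
  \<comment> \<open>On the circle u' = 2 pi i u, so u' cancels one of the two powers of u in the
    denominator.\<close>
  from has_integral_mult_right[OF this, of "1 / (2 * pi * \<i>)"]
  have "((\<lambda>t. F (circlepath 0 r t) / circlepath 0 r t) has_integral frechet_derivative f (at x) v) {0..1}"
    using r by (auto simp: circlepath field_simps power2_eq_square)
  then show ?thesis by (simp add: F_def integral_unique)
qed

text \<open>One radius serves all centres near \<open>x0\<close>. The circle formula then holds on a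
  whole neighbourhood with a fixed domain of integration, and can be differentiated with respect to
  the centre.\<close>

lemma uniform_circle_in_open:
  fixes x0 v :: "complex^'m"
  assumes "open S" "x0 \<in> S"
  obtains \<epsilon> r where "\<epsilon> > 0" "r > 0" "\<And>x z. x \<in> ball x0 \<epsilon> \<Longrightarrow> norm z \<le> r \<Longrightarrow> x + z *s v \<in> S"
proof -
  obtain e where e: "e > 0" "ball x0 e \<subseteq> S" using assms by (meson open_contains_ball)
  \<comment> \<open>Half of \<open>e\<close> is left for the centre, half for the displacement along
    \<open>v\<close>; the summand 1 keeps the denominator positive when \<open>v\<close> is
    0.\<close>
  define r where "r = e / (2 * (norm v + 1))"
  have pos: "2 * (norm v + 1) > 0" by (simp add: add_nonneg_pos)
  have r: "r > 0" unfolding r_def using e pos by simp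
  have rv: "r * norm v \<le> e / 2"
    using e pos by (simp add: r_def field_simps)
  show thesis
  proof (rule that[of "e/2" r])
    fix x z assume x: "x \<in> ball x0 (e/2)" and z: "norm (z::complex) \<le> r"
    have "norm (z *s v) \<le> r * norm v" using z by (simp add: norm_smult_vec mult_right_mono)
    then have "norm (z *s v) \<le> e/2" using rv by linarith
    then have "dist x0 (x + z *s v) < e"
      using x norm_triangle_ineq4[of "x0 - x" "z *s v"] by (simp add: dist_norm algebra_simps)
    then show "x + z *s v \<in> S" using e by auto
  qed (use e r in auto)
qed

lemma continuous_on_circle_map [continuous_intros]:
  "continuous_on A (\<lambda>p. fst p + circlepath 0 r (snd p) *s (v::complex^'m))"
proof -
  have "continuous_on A (\<lambda>p. circlepath 0 r (snd p))"
    unfolding circlepath by (intro continuous_intros)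
  from bounded_linear.continuous_on[OF bounded_linear_smult_right this]
  show ?thesis by (intro continuous_intros) auto
qed

lemma circlepath_nonzero: "r > 0 \<Longrightarrow> circlepath 0 r t \<noteq> 0"
  by (simp add: circlepath)

lemma norm_circlepath: "r > 0 \<Longrightarrow> norm (circlepath 0 r t) = r"
proof -
  assume "r > 0"
  moreover have "norm (exp (2 * of_real pi * \<i> * of_real t)) = 1" by simp
  ultimately show ?thesis by (simp add: circlepath norm_mult)
qed

text \<open>Joint continuity in centre and circle parameter is what continuity of a parameter
  integral and differentiation under the integral sign ask for.\<close>

lemma continuous_on_circle_integrand:
  assumes g: "continuous_on S (g :: complex^'m \<Rightarrow> complex)" and "r > 0"
    and sub: "\<And>x z. x \<in> U \<Longrightarrow> norm z \<le> r \<Longrightarrow> x + z *s v \<in> S"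
  shows "continuous_on (U \<times> T) (\<lambda>(x, t). g (x + circlepath 0 r t *s v) / circlepath 0 r t)"
proof -
  have "continuous_on (U \<times> T) (\<lambda>p. g (fst p + circlepath 0 r (snd p) *s v))"
    by (rule continuous_on_compose2[OF g continuous_on_circle_map])
       (auto intro!: sub simp: norm_circlepath assms)
  moreover have "continuous_on (U \<times> T) (\<lambda>p. circlepath 0 r (snd p))"
    unfolding circlepath by (intro continuous_intros)
  ultimately show ?thesis
    unfolding split_beta using \<open>r > 0\<close> by (intro continuous_intros) (auto simp: circlepath_nonzero)
qed

text \<open>Continuity of the derivative is no part of the definition of holomorphy. It follows
  because the circle formula expresses the derivative through values of \<open>f\<close> alone, and
  \<open>f\<close> is continuous.\<close>

lemma continuous_on_frechet_derivative:
  fixes f :: "complex^'m \<Rightarrow> complex"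
  assumes S: "open S" and f: "holomorphic_fun_on S f"
  shows "continuous_on S (\<lambda>x. frechet_derivative f (at x) v)"
proof (rule continuous_at_imp_continuous_on, rule ballI)
  fix x0 assume "x0 \<in> S"
  then obtain e r where er: "e > 0" "r > 0" "\<And>x z. x \<in> ball x0 e \<Longrightarrow> norm z \<le> r \<Longrightarrow> x + z *s v \<in> S"
    using uniform_circle_in_open[OF S] by metis
  have "continuous_on (ball x0 e) (\<lambda>x. integral (cbox 0 1) (\<lambda>t. f (x + circlepath 0 r t *s v) / circlepath 0 r t))"
    by (intro integral_continuous_on_param continuous_on_circle_integrand[OF holomorphic_fun_on_imp_continuous_on[OF f]] er)
  also have "?this \<longleftrightarrow> continuous_on (ball x0 e) (\<lambda>x. frechet_derivative f (at x) v)"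
    by (intro continuous_on_cong refl) (simp add: frechet_derivative_circle_integral[OF f \<open>r > 0\<close> er(3)])
  finally show "isCont (\<lambda>x. frechet_derivative f (at x) v) x0"
    using \<open>e > 0\<close> by (simp add: continuous_on_eq_continuous_at)
qed

text \<open>Differentiation of the circle formula under the integral sign. The integral is kept
  explicit because both the complex linearity and the symmetry of second derivatives are read off
  from it.\<close>

lemma has_derivative_frechet_derivative:
  fixes f :: "complex^'m \<Rightarrow> complex"
  assumes S: "open S" and f: "holomorphic_fun_on S f"
    and e: "e > 0" and r: "r > 0" and er: "\<And>x z. x \<in> ball x0 e \<Longrightarrow> norm z \<le> r \<Longrightarrow> x + z *s v \<in> S"
  shows "((\<lambda>x. frechet_derivative f (at x) v) has_derivative
     (\<lambda>w. integral {0..1} (\<lambda>t. frechet_derivative f (at (x0 + circlepath 0 r t *s v)) w / circlepath 0 r t))) (at x0)"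
proof -
  \<comment> \<open>The integrand's derivative is treated as an operator-valued function, all
    directions \<open>w\<close> at once, and is applied to \<open>w\<close> only after
    integration.\<close>
  define fx where "fx x t = Blinfun (\<lambda>w. frechet_derivative f (at (x + circlepath 0 r t *s v)) w / circlepath 0 r t)" for x t
  have on_circle: "x + circlepath 0 r t *s v \<in> S" if "x \<in> ball x0 e" for x t
    using er[OF that] norm_circlepath[OF r] by simp
  have fx: "blinfun_apply (fx x t) = (\<lambda>w. frechet_derivative f (at (x + circlepath 0 r t *s v)) w / circlepath 0 r t)"
    if "x \<in> ball x0 e" for x t
    unfolding fx_def
    by (intro bounded_linear_Blinfun_apply bounded_linear_divide[THEN bounded_linear_compose]
       complex_linear_form_bounded_linear holomorphic_fun_on_frechet(2)[OF f on_circle[OF that]])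
  have der: "((\<lambda>x. f (x + circlepath 0 r t *s v) / circlepath 0 r t) has_derivative blinfun_apply (fx x t)) (at x within ball x0 e)"
    if "x \<in> ball x0 e" for x t
  proof -
    have "((\<lambda>x. x + circlepath 0 r t *s v) has_derivative (\<lambda>h. h)) (at x)"
      by (auto intro!: derivative_eq_intros)
    from diff_chain_at[OF this holomorphic_fun_on_frechet(1)[OF f on_circle[OF that]]]
    have "((\<lambda>x. f (x + circlepath 0 r t *s v) / circlepath 0 r t) has_derivative blinfun_apply (fx x t)) (at x)"
      unfolding fx[OF that] o_def by (rule bounded_linear.has_derivative[OF bounded_linear_divide])
    then show ?thesis by (rule has_derivative_at_withinI)
  qed
  \<comment> \<open>In finite dimension an operator-valued map is continuous once its value at each
    vector is; this is where continuity of the first derivative enters.\<close>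
  have cont: "continuous_on (ball x0 e \<times> cbox 0 1) (\<lambda>(x, t). fx x t)"
  proof (rule continuous_on_blinfun_componentwise)
    fix i :: "complex^'m"
    have "continuous_on (ball x0 e \<times> cbox 0 1) (\<lambda>(x, t). frechet_derivative f (at (x + circlepath 0 r t *s v)) i / circlepath 0 r t)"
      by (intro continuous_on_circle_integrand[where g = "\<lambda>x. frechet_derivative f (at x) i" and S = S]
         continuous_on_frechet_derivative[OF S f] r er)
    then show "continuous_on (ball x0 e \<times> cbox 0 1) (\<lambda>p. blinfun_apply (case p of (x, t) \<Rightarrow> fx x t) i)"
      by (rule continuous_on_eq) (auto simp: fx)
  qed
  have int: "fx x0 integrable_on cbox 0 1"
  proof (rule integrable_continuous)
    have "continuous_on (cbox 0 1) (\<lambda>t. (x0, t :: real))" by (intro continuous_intros)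
    moreover have "(\<lambda>t. (x0, t :: real)) ` cbox 0 1 \<subseteq> ball x0 e \<times> cbox 0 1" using e by auto
    ultimately show "continuous_on (cbox 0 1) (fx x0)"
      using continuous_on_compose2[OF cont] by fastforce
  qed
  have "((\<lambda>x. integral (cbox 0 1) (\<lambda>t. f (x + circlepath 0 r t *s v) / circlepath 0 r t)) has_derivative
      integral (cbox 0 1) (fx x0)) (at x0 within ball x0 e)"
  proof (rule leibniz_rule[OF der _ cont])
    fix x assume x: "x \<in> ball x0 e"
    have "continuous_on (ball x0 e \<times> cbox 0 1) (\<lambda>(x, t). f (x + circlepath 0 r t *s v) / circlepath 0 r t)"
      by (intro continuous_on_circle_integrand[OF holomorphic_fun_on_imp_continuous_on[OF f]] r er)
    moreover have "continuous_on (cbox 0 1) (\<lambda>t. (x, t :: real))" by (intro continuous_intros)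
    ultimately have "continuous_on (cbox 0 1) (\<lambda>t. case (x, t) of (x, t) \<Rightarrow> f (x + circlepath 0 r t *s v) / circlepath 0 r t)"
      by (rule continuous_on_compose2) (use x in auto)
    then show "(\<lambda>t. f (x + circlepath 0 r t *s v) / circlepath 0 r t) integrable_on cbox 0 1"
      by (intro integrable_continuous) simp
  qed (use e in auto)
  then have "((\<lambda>x. integral (cbox 0 1) (\<lambda>t. f (x + circlepath 0 r t *s v) / circlepath 0 r t)) has_derivative
      integral (cbox 0 1) (fx x0)) (at x0)"
    using e by (simp add: at_within_open[of x0 "ball x0 e"])
  then have "((\<lambda>x. frechet_derivative f (at x) v) has_derivative integral (cbox 0 1) (fx x0)) (at x0)"
    by (rule has_derivative_transform_within_open[of _ _ _ _ "ball x0 e"])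
       (use e in \<open>auto intro!: frechet_derivative_circle_integral[OF f r, symmetric] er\<close>)
  also have "blinfun_apply (integral (cbox 0 1) (fx x0)) =
      (\<lambda>w. integral {0..1} (\<lambda>t. frechet_derivative f (at (x0 + circlepath 0 r t *s v)) w / circlepath 0 r t))"
    using e blinfun_apply_integral[OF int] by (auto simp: fx fun_eq_iff)
  finally show ?thesis .
qed

proposition holomorphic_fun_on_frechet_derivative:
  fixes f :: "complex^'m \<Rightarrow> complex"
  assumes S: "open S" and f: "holomorphic_fun_on S f"
  shows "holomorphic_fun_on S (\<lambda>x. frechet_derivative f (at x) v)"
  unfolding holomorphic_fun_on_def
proof
  fix x0 assume "x0 \<in> S"
  then obtain e r where er: "e > 0" "r > 0" "\<And>x z. x \<in> ball x0 e \<Longrightarrow> norm z \<le> r \<Longrightarrow> x + z *s v \<in> S"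
    using uniform_circle_in_open[OF S] by metis
  define D where "D w = integral {0..1} (\<lambda>t. frechet_derivative f (at (x0 + circlepath 0 r t *s v)) w / circlepath 0 r t)" for w
  have D: "((\<lambda>x. frechet_derivative f (at x) v) has_derivative D) (at x0)"
    unfolding D_def by (rule has_derivative_frechet_derivative[OF S f er])
  have lin: "complex_linear_form (frechet_derivative f (at (x0 + circlepath 0 r t *s v)))" for t
    by (rule holomorphic_fun_on_frechet(2)[OF f er(3)]) (use er norm_circlepath in auto)
  have "complex_linear_form D"
    unfolding complex_linear_form_iff
  proof (intro conjI allI)
    \<comment> \<open>Additivity comes with real differentiability; only complex homogeneity has to
      be carried through the integral.\<close>
    show "D (x + y) = D x + D y" for x y
      using has_derivative_bounded_linear[OF D] by (simp add: linear_simps)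
    show "D (c *s x) = c * D x" for c x
      using lin unfolding D_def complex_linear_form_iff
      by (simp flip: integral_mult_right times_divide_eq_right)
  qed
  with D show "\<exists>D. ((\<lambda>x. frechet_derivative f (at x) v) has_derivative D) (at x0) \<and> complex_linear_form D"
    by blast
qed

text \<open>Differentiating Cauchy's formula for \<open>\<partial>\<^sub>v f\<close> under the integral sign gives
  Cauchy's formula for \<open>\<partial>\<^sub>v (\<partial>\<^sub>w f)\<close>.\<close>

proposition frechet_derivative_commute:
  fixes f :: "complex^'m \<Rightarrow> complex"
  assumes S: "open S" and f: "holomorphic_fun_on S f" and x0: "x0 \<in> S"
  shows "frechet_derivative (\<lambda>x. frechet_derivative f (at x) v) (at x0) w =
         frechet_derivative (\<lambda>x. frechet_derivative f (at x) w) (at x0) v"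
proof -
  obtain e r where er: "e > 0" "r > 0" "\<And>x z. x \<in> ball x0 e \<Longrightarrow> norm z \<le> r \<Longrightarrow> x + z *s v \<in> S"
    using uniform_circle_in_open[OF S x0] by metis
  have "frechet_derivative (\<lambda>x. frechet_derivative f (at x) v) (at x0) w =
      integral {0..1} (\<lambda>t. frechet_derivative f (at (x0 + circlepath 0 r t *s v)) w / circlepath 0 r t)"
    by (rule fun_cong[OF frechet_derivative_at[OF has_derivative_frechet_derivative[OF S f er], symmetric]])
  also have "\<dots> = frechet_derivative (\<lambda>x. frechet_derivative f (at x) w) (at x0) v"
    by (rule frechet_derivative_circle_integral[OF holomorphic_fun_on_frechet_derivative[OF S f] er(2), symmetric])
       (use er in auto)
  finally show ?thesis .
qed

lemma holomorphic_map_on_frechet_derivative: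
  fixes f :: "complex^'m \<Rightarrow> complex^'k"
  assumes S: "open S" and f: "holomorphic_map_on S f"
  shows "holomorphic_map_on S (\<lambda>x. frechet_derivative f (at x) v)"
proof -
  have "holomorphic_fun_on S (\<lambda>x. frechet_derivative f (at x) v $ i)" for i
  proof -
    have "holomorphic_fun_on S (\<lambda>x. frechet_derivative (\<lambda>x. f x $ i) (at x) v)"
      using f by (intro holomorphic_fun_on_frechet_derivative[OF S]) (auto simp: holomorphic_map_on_def)
    then show ?thesis
      unfolding holomorphic_fun_on_def
      by (metis (no_types, lifting) S has_derivative_transform_within_open holomorphic_map_on_frechet(3)[OF f])
  qed
  then show ?thesis by (simp add: holomorphic_map_on_def)
qed

lemma frechet_derivative_cong_open:
  assumes "open S" "x \<in> S" "\<And>y. y \<in> S \<Longrightarrow> f y = g y"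
  shows "frechet_derivative f (at x) = frechet_derivative g (at x)"
proof -
  have "(f has_derivative D) (at x) \<longleftrightarrow> (g has_derivative D) (at x)" for D
    using assms by (auto elim: has_derivative_transform_within_open)
  then show ?thesis by (simp add: frechet_derivative_def)
qed

lemma frechet_derivative_commute_map:
  fixes f :: "complex^'m \<Rightarrow> complex^'k"
  assumes S: "open S" and f: "holomorphic_map_on S f" and x: "x \<in> S"
  shows "frechet_derivative (\<lambda>x. frechet_derivative f (at x) v) (at x) w =
         frechet_derivative (\<lambda>x. frechet_derivative f (at x) w) (at x) v"
proof (rule vec_eq_iff[THEN iffD2], rule)
  fix i
  have fi: "holomorphic_fun_on S (\<lambda>x. f x $ i)" using f by (simp add: holomorphic_map_on_def)
  have "frechet_derivative (\<lambda>x. frechet_derivative f (at x) v) (at x) w $ i =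
      frechet_derivative (\<lambda>x. frechet_derivative (\<lambda>x. f x $ i) (at x) v) (at x) w" for v w
    unfolding holomorphic_map_on_frechet(3)[OF holomorphic_map_on_frechet_derivative[OF S f] x]
    by (rule fun_cong[OF frechet_derivative_cong_open[OF S x]]) (rule holomorphic_map_on_frechet(3)[OF f])
  then show "frechet_derivative (\<lambda>x. frechet_derivative f (at x) v) (at x) w $ i =
      frechet_derivative (\<lambda>x. frechet_derivative f (at x) w) (at x) v $ i"
    using frechet_derivative_commute[OF S fi x] by simp
qed

section \<open>Curvature of a connection given by its Christoffel map\<close>

text \<open>A product rule for a family of linear maps whose derivative is known at each fixed
  vector only. Expansion along the axes turns it into a finite sum of scalar multiples. Three
  instances differentiate a covariant derivative: one for the derivative of \<open>Z\<close>, one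
  for each argument of the Christoffel map.\<close>

lemma has_derivative_linear_family:
  fixes L :: "complex^'m \<Rightarrow> complex^'k \<Rightarrow> complex^'l"
  assumes V: "open V" "x \<in> V" and lin: "\<And>y. y \<in> V \<Longrightarrow> Vector_Spaces.linear (*s) (*s) (L y)"
    and D: "\<And>v. ((\<lambda>y. L y v) has_derivative D v) (at x)" and Y: "(Y has_derivative Y') (at x)"
  shows "((\<lambda>y. L y (Y y)) has_derivative (\<lambda>u. D (Y x) u + L x (Y' u))) (at x)"
proof -
  have expand: "L y v = (\<Sum>i\<in>UNIV. v $ i *s L y (axis i 1))" if "y \<in> V" for y v
    using lin[OF that] complex_linear_form_expansion[of "\<lambda>v. L y v $ i" v for i]
    by (simp add: clinear_map_nth_iff vec_eq_iff)
  \<comment> \<open>\<open>D\<close> is given vector by vector; uniqueness of derivatives forces it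
    to be linear in \<open>v\<close>.\<close>
  have "((\<lambda>y. L y v) has_derivative (\<lambda>u. \<Sum>i\<in>UNIV. v $ i *s D (axis i 1) u)) (at x)" for v
  proof (rule has_derivative_transform_within_open[OF _ V expand[symmetric]])
    show "((\<lambda>y. \<Sum>i\<in>UNIV. v $ i *s L y (axis i 1)) has_derivative (\<lambda>u. \<Sum>i\<in>UNIV. v $ i *s D (axis i 1) u)) (at x)"
      by (intro has_derivative_sum bounded_linear.has_derivative[OF bounded_bilinear.bounded_linear_right[OF bounded_bilinear_smult_vec]] D)
  qed auto
  then have Dv: "D v = (\<lambda>u. \<Sum>i\<in>UNIV. v $ i *s D (axis i 1) u)" for v
    using D has_derivative_unique by blast
  have "((\<lambda>y. \<Sum>i\<in>UNIV. Y y $ i *s L y (axis i 1)) has_derivative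
     (\<lambda>u. \<Sum>i\<in>UNIV. Y x $ i *s D (axis i 1) u + Y' u $ i *s L x (axis i 1))) (at x)"
    by (intro has_derivative_sum bounded_bilinear.FDERIV[OF bounded_bilinear_smult_vec] D
        bounded_linear.has_derivative[OF bounded_linear_vec_nth Y])
  also have "(\<lambda>u. \<Sum>i\<in>UNIV. Y x $ i *s D (axis i 1) u + Y' u $ i *s L x (axis i 1)) = (\<lambda>u. D (Y x) u + L x (Y' u))"
    using V by (simp add: sum.distrib expand[symmetric] Dv[of "Y x"])
  finally show ?thesis
    by (rule has_derivative_transform_within_open[OF _ V]) (simp add: expand[symmetric])
qed

text \<open>The curvature is an exterior derivative of \<open>B\<close> plus a commutator of the
  operators \<open>B x u\<close>. The hypotheses \<open>closed\<close> and \<open>comm\<close>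
  annihilate the two parts separately. The terms with derivatives of \<open>X\<close> and
  \<open>Y\<close> cancel against the bracket, and the second derivatives of \<open>Z\<close> cancel
  by symmetry.\<close>

proposition flat_connection_onI:
  fixes B :: "complex^'m \<Rightarrow> complex^'m \<Rightarrow> complex^'m \<Rightarrow> complex^'m"
  assumes \<Omega>: "open \<Omega>"
    and bil: "\<And>x. x \<in> \<Omega> \<Longrightarrow> complex_bilinear_map (B x)"
    and hol: "\<And>u v. holomorphic_map_on \<Omega> (\<lambda>x. B x u v)"
    and closed: "\<And>x u v w. x \<in> \<Omega> \<Longrightarrow>
      frechet_derivative (\<lambda>y. B y v w) (at x) u = frechet_derivative (\<lambda>y. B y u w) (at x) v"
    and comm: "\<And>x u v w. x \<in> \<Omega> \<Longrightarrow> B x u (B x v w) = B x v (B x u w)"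
  shows "flat_connection_on \<Omega> B"
  unfolding flat_connection_on_def
proof (intro allI impI ballI, elim conjE)
  fix V and X Y Z :: "complex^'m \<Rightarrow> complex^'m" and x
  assume V: "open V" "V \<subseteq> \<Omega>" and X: "holomorphic_map_on V X" and Y: "holomorphic_map_on V Y"
    and Z: "holomorphic_map_on V Z" and x: "x \<in> V"
  then have x\<Omega>: "x \<in> \<Omega>" by auto
  have lin1: "Vector_Spaces.linear (*s) (*s) (\<lambda>u. B y u v)"
    and lin2: "Vector_Spaces.linear (*s) (*s) (B y u)" if "y \<in> V" for y u v
    using bil[of y] that V by (auto simp: complex_bilinear_map_def)
  define Z2 where "Z2 u v = frechet_derivative (\<lambda>x. frechet_derivative Z (at x) u) (at x) v" for u v
  define DB where "DB u v w = frechet_derivative (\<lambda>y. B y u v) (at x) w" for u v w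
  define Z' where "Z' = frechet_derivative Z (at x)"
  have Z': "(Z has_derivative Z') (at x)" unfolding Z'_def by (rule holomorphic_map_on_frechet[OF Z x])
  \<comment> \<open>\<open>Y\<close> is generalized here so that the same expansion serves for
    \<open>X\<close>.\<close>
  have second: "frechet_derivative (covariant_derivative B Y Z) (at x) u =
      Z2 (Y x) u + Z' (frechet_derivative Y (at x) u) +
      (DB (Y x) (Z x) u + B x (Y x) (Z' u) + B x (frechet_derivative Y (at x) u) (Z x))"
    if Y: "holomorphic_map_on V Y" for Y u
  proof -
    define Y' where "Y' = frechet_derivative Y (at x)"
    have Y': "(Y has_derivative Y') (at x)" unfolding Y'_def by (rule holomorphic_map_on_frechet[OF Y x])
    have 1: "((\<lambda>y. frechet_derivative Z (at y) (Y y)) has_derivative (\<lambda>u. Z2 (Y x) u + Z' (Y' u))) (at x)"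
      unfolding Z'_def Z2_def
      by (intro has_derivative_linear_family[OF V(1) x holomorphic_map_on_frechet(2)[OF Z]]
          holomorphic_map_on_frechet(1)[OF holomorphic_map_on_frechet_derivative[OF V(1) Z] x] Y')
    have 2: "((\<lambda>y. B y v (Z y)) has_derivative (\<lambda>u. DB v (Z x) u + B x v (Z' u))) (at x)" for v
      unfolding DB_def
      by (intro has_derivative_linear_family[OF V(1) x lin2]
          holomorphic_map_on_frechet(1)[OF hol x\<Omega>] Z')
    have 3: "((\<lambda>y. B y (Y y) (Z y)) has_derivative (\<lambda>u. (DB (Y x) (Z x) u + B x (Y x) (Z' u)) + B x (Y' u) (Z x))) (at x)"
      by (rule has_derivative_linear_family[OF V(1) x lin1 2 Y'])
    have "(covariant_derivative B Y Z has_derivative (\<lambda>u. (Z2 (Y x) u + Z' (Y' u)) +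
        (DB (Y x) (Z x) u + B x (Y x) (Z' u) + B x (Y' u) (Z x)))) (at x)"
      unfolding covariant_derivative_def using has_derivative_add[OF 1 3] by simp
    then show ?thesis by (simp add: frechet_derivative_at[symmetric] Y'_def)
  qed
  have sym: "Z2 (Y x) (X x) = Z2 (X x) (Y x)"
    unfolding Z2_def by (rule frechet_derivative_commute_map[OF V(1) Z x])
  have sym2: "DB (Y x) (Z x) (X x) = DB (X x) (Z x) (Y x)"
    unfolding DB_def by (rule closed[OF x\<Omega>])
  have diff1: "B x (u - v) w = B x u w - B x v w" and add2: "B x w (u + v) = B x w u + B x w v" for u v w
    using linear_diff[OF bounded_linear.linear[OF clinear_map_bounded_linear[OF lin1[OF x]]]]
      linear_add[OF bounded_linear.linear[OF clinear_map_bounded_linear[OF lin2[OF x]]]] by auto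
  have diffZ: "Z' (u - v) = Z' u - Z' v" for u v
    using has_derivative_bounded_linear[OF Z'] by (simp add: linear_simps)
  show "covariant_derivative B X (covariant_derivative B Y Z) x
      - covariant_derivative B Y (covariant_derivative B X Z) x
      - covariant_derivative B (lie_bracket X Y) Z x = 0"
    unfolding covariant_derivative_def[of B X "covariant_derivative B Y Z"]
      covariant_derivative_def[of B Y "covariant_derivative B X Z"] second[OF X] second[OF Y]
    unfolding covariant_derivative_def Z'_def[symmetric] lie_bracket_def diff1 add2 diffZ sym sym2
    by (simp add: comm[OF x\<Omega>, of "X x"])
qed

section \<open>Reflection-invariant forms\<close>

text \<open>The gradient of the covector: it represents \<alpha> through the standard inner
  product.\<close>

definition root_vector :: "'n::finite covector \<Rightarrow> real^'n" where
  "root_vector \<alpha> = (\<chi> i. blinfun_apply \<alpha> (axis i 1))"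

text \<open>Without conjugation, hence complex bilinear: the complexification of the Euclidean inner
  product, not the Hermitian form.\<close>

definition cdot :: "complex^'n \<Rightarrow> complex^'n \<Rightarrow> complex" where
  "cdot u v = (\<Sum>i\<in>UNIV. u $ i * v $ i)"

lemma blinfun_apply_root_vector: "blinfun_apply \<alpha> v = root_vector \<alpha> \<bullet> v"
proof -
  have "blinfun_apply \<alpha> v = blinfun_apply \<alpha> (\<Sum>i\<in>UNIV. v $ i *\<^sub>R axis i 1)"
    using basis_expansion[of v] by (simp add: scalar_mult_eq_scaleR)
  also have "\<dots> = root_vector \<alpha> \<bullet> v"
    by (simp add: blinfun.sum_right blinfun.scaleR_right root_vector_def inner_vec_def mult.commute)
  finally show ?thesis .
qed

lemma root_vector_add: "root_vector (\<alpha> + \<beta>) = root_vector \<alpha> + root_vector \<beta>"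
  and root_vector_diff: "root_vector (\<alpha> - \<beta>) = root_vector \<alpha> - root_vector \<beta>"
  and root_vector_scaleR: "root_vector (c *\<^sub>R \<alpha>) = c *\<^sub>R root_vector \<alpha>"
  and root_vector_zero: "root_vector 0 = 0"
  by (simp_all add: root_vector_def vec_eq_iff blinfun.add_left blinfun.diff_left blinfun.scaleR_left)

lemma root_vector_eq_0_iff: "root_vector \<alpha> = 0 \<longleftrightarrow> \<alpha> = 0"
  by (auto simp: root_vector_zero blinfun_apply_root_vector intro: blinfun_eqI)

lemma coroot_eq: "coroot \<alpha> = (2 / (root_vector \<alpha> \<bullet> root_vector \<alpha>)) *\<^sub>R root_vector \<alpha>"
  by (simp add: coroot_def Let_def root_vector_def)

lemma cform_eq_cdot: "cform \<alpha> z = cdot (cvec (root_vector \<alpha>)) z"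
  by (simp add: cform_def cdot_def complex_eq_iff blinfun_apply_root_vector inner_vec_def re_vec_def im_vec_def cvec_def)

lemma cdot_add_left: "cdot (u + v) w = cdot u w + cdot v w"
  and cdot_add_right: "cdot u (v + w) = cdot u v + cdot u w"
  and cdot_diff_right: "cdot u (v - w) = cdot u v - cdot u w"
  and cdot_smult_left: "cdot (c *s u) w = c * cdot u w"
  and cdot_smult_right: "cdot u (c *s w) = c * cdot u w"
  and cdot_zero_left: "cdot 0 w = 0"
  and cdot_zero_right: "cdot u 0 = 0"
  by (simp_all add: cdot_def sum.distrib sum_subtractf algebra_simps sum_distrib_left)

lemma cdot_commute: "cdot u v = cdot v u"
  by (simp add: cdot_def mult.commute)

lemma cdot_axis: "cdot u (axis i 1) = u $ i"
  by (simp add: cdot_def axis_def if_distrib cong: if_cong)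

lemma cdot_cvec: "cdot (cvec u) (cvec v) = of_real (u \<bullet> v)"
  by (simp add: cdot_def cvec_def inner_vec_def)

lemma cvec_add: "cvec (u + v) = cvec u + cvec v"
  and cvec_scaleR: "cvec (c *\<^sub>R u) = of_real c *s cvec u"
  and cvec_zero: "cvec 0 = 0"
  by (simp_all add: cvec_def vec_eq_iff)

lemma cvec_axis: "cvec (axis i 1) = axis i 1"
  by (simp add: cvec_def axis_def vec_eq_iff)

lemma cform_add: "cform \<alpha> (u + v) = cform \<alpha> u + cform \<alpha> v"
  and cform_diff: "cform \<alpha> (u - v) = cform \<alpha> u - cform \<alpha> v"
  and cform_smult: "cform \<alpha> (c *s u) = c * cform \<alpha> u"
  and cform_zero: "cform \<alpha> 0 = 0"
  by (simp_all add: cform_eq_cdot cdot_add_right cdot_diff_right cdot_smult_right cdot_zero_right)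

lemma cform_add_left: "cform (\<alpha> + \<beta>) u = cform \<alpha> u + cform \<beta> u"
  and cform_scaleR_left: "cform (c *\<^sub>R \<alpha>) u = of_real c * cform \<alpha> u"
  and cform_zero_left: "cform 0 u = 0"
  by (simp_all add: cform_eq_cdot root_vector_add root_vector_scaleR root_vector_zero cvec_add cvec_scaleR
     cvec_zero cdot_add_left cdot_smult_left cdot_zero_left)

lemma cform_sum_left: "cform (\<Sum>i\<in>A. f i) u = (\<Sum>i\<in>A. cform (f i) u)"
  by (induction A rule: infinite_finite_induct) (auto simp: cform_zero_left cform_add_left)

lemma cform_sum: "cform \<alpha> (\<Sum>i\<in>A. f i) = (\<Sum>i\<in>A. cform \<alpha> (f i))"
  by (induction A rule: infinite_finite_induct) (auto simp: cform_zero cform_add)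

lemma cform_cvec: "cform \<alpha> (cvec v) = of_real (blinfun_apply \<alpha> v)"
  by (simp add: cform_eq_cdot cdot_cvec blinfun_apply_root_vector)

lemma cmap_reflection: "cmap (reflection \<alpha>) u = u - cform \<alpha> u *s cvec (coroot \<alpha>)"
  by (simp add: vec_eq_iff cmap_def reflection_def cform_def cvec_def re_vec_def im_vec_def complex_eq_iff algebra_simps)

lemma root_coroot: "\<alpha> \<noteq> 0 \<Longrightarrow> blinfun_apply \<alpha> (coroot \<alpha>) = 2"
  by (simp add: coroot_eq blinfun_apply_root_vector root_vector_eq_0_iff)

text \<open>Evaluating invariance at \<open>(u, \<alpha>\<^sup>\<or>)\<close> gives \<open>a u \<alpha>\<^sup>\<or> = q\<^sub>\<alpha> (u \<bullet> \<alpha>\<^sup>\<or>)\<close>, and comparing the two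
  values of \<open>a \<alpha>\<^sup>\<or> \<beta>\<^sup>\<or>\<close> shows \<open>q\<^sub>\<alpha> = q\<^sub>\<beta>\<close> unless \<open>\<alpha>\<close> and \<open>\<beta>\<close> are orthogonal.\<close>

proposition reflection_invariant_form_scalar:
  fixes R :: "'n::finite covector set" and a :: "complex^'n \<Rightarrow> complex^'n \<Rightarrow> complex"
  assumes R: "root_system R" and irr: "irreducible_root_system R"
    and bil: "complex_bilinear_form a" and sym: "\<And>u v. a u v = a v u"
    and inv: "\<And>\<alpha> u v. \<alpha> \<in> R \<Longrightarrow> a (cmap (reflection \<alpha>) u) (cmap (reflection \<alpha>) v) = a u v"
  obtains c where "\<And>u v. a u v = c * cdot u v"
proof -
  have add: "a u (v + w) = a u v + a u w" and smult: "a u (z *s v) = z * a u v"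
    and add': "a (u + v) w = a u w + a v w" and smult': "a (z *s u) v = z * a u v" for u v w z
    using bil by (auto simp: complex_bilinear_form_def complex_linear_form_iff)
  have diff: "a (u - v) w = a u w - a v w" and minus: "a u (- v) = - a u v" for u v w
    using add'[of "u - v" v w] smult[of u "-1" v] by (simp_all add: vector_sneg_minus1[symmetric])
  have nz: "\<alpha> \<noteq> 0" if "\<alpha> \<in> R" for \<alpha> using R that by (auto simp: root_system_def)
  \<comment> \<open>The only possible ratio between \<open>a\<close> and the Euclidean form along
    \<alpha>, found by evaluating both at the root vector.\<close>
  define q where "q \<alpha> = a (cvec (root_vector \<alpha>)) (cvec (root_vector \<alpha>)) / of_real (root_vector \<alpha> \<bullet> root_vector \<alpha>)" for \<alpha>
  have key: "a u (cvec (root_vector \<alpha>)) = q \<alpha> * cform \<alpha> u" if "\<alpha> \<in> R" for \<alpha> u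
  proof -
    have n: "root_vector \<alpha> \<noteq> 0" using nz[OF that] root_vector_eq_0_iff by blast
    define r where "r = cvec (root_vector \<alpha>)"
    have co: "cvec (coroot \<alpha>) = of_real (2 / (root_vector \<alpha> \<bullet> root_vector \<alpha>)) *s r"
      by (simp add: coroot_eq cvec_scaleR r_def)
    have sr: "cmap (reflection \<alpha>) r = - r"
      using n by (simp add: cmap_reflection r_def cform_cvec blinfun_apply_root_vector co[unfolded r_def] vec_eq_iff)
    have "a (u - cform \<alpha> u *s cvec (coroot \<alpha>)) (- r) = a u r"
      using inv[OF that, of u r] by (simp only: sr) (simp only: cmap_reflection)
    then have "2 * a u r = cform \<alpha> u * (of_real (2 / (root_vector \<alpha> \<bullet> root_vector \<alpha>)) * a r r)"
      by (simp add: minus diff smult' co algebra_simps del: of_real_divide)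
    then show ?thesis using n by (simp add: q_def r_def field_simps)
  qed
  have qeq: "q \<alpha> = q \<beta>" if "\<alpha> \<in> R" "\<beta> \<in> R" "blinfun_apply \<beta> (coroot \<alpha>) \<noteq> 0" for \<alpha> \<beta>
  proof -
    have "cform \<alpha> (cvec (root_vector \<beta>)) = cform \<beta> (cvec (root_vector \<alpha>))"
      by (simp add: cform_cvec blinfun_apply_root_vector inner_commute)
    moreover have "cform \<beta> (cvec (root_vector \<alpha>)) \<noteq> 0"
      using that(3) by (auto simp: cform_cvec blinfun_apply_root_vector coroot_eq)
    ultimately show ?thesis
      using key[OF that(1), of "cvec (root_vector \<beta>)"] key[OF that(2), of "cvec (root_vector \<alpha>)"]
        sym[of "cvec (root_vector \<alpha>)"] by simp
  qed
  have "R \<noteq> {}" using irr unfolding irreducible_root_system_def by (rule conjunct1)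
  then obtain \<alpha>0 where \<alpha>0: "\<alpha>0 \<in> R" by blast
  have qconst: "q \<alpha> = q \<alpha>0" if "\<alpha> \<in> R" for \<alpha>
  proof (rule ccontr)
    assume "q \<alpha> \<noteq> q \<alpha>0"
    \<comment> \<open>A second value of \<open>q\<close> would split the roots into two nonempty
      orthogonal classes, contrary to irreducibility.\<close>
    define R1 R2 where "R1 = {\<beta>\<in>R. q \<beta> = q \<alpha>0}" and "R2 = {\<beta>\<in>R. q \<beta> \<noteq> q \<alpha>0}"
    have "R1 \<noteq> {}" "R2 \<noteq> {}" using \<alpha>0 that \<open>q \<alpha> \<noteq> q \<alpha>0\<close> by (auto simp: R1_def R2_def)
    moreover have "R1 \<inter> R2 = {}" "R1 \<union> R2 = R" by (auto simp: R1_def R2_def)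
    moreover have "\<forall>\<alpha>\<in>R1. \<forall>\<beta>\<in>R2. blinfun_apply \<beta> (coroot \<alpha>) = 0"
    proof (intro ballI, rule ccontr)
      fix \<alpha> \<beta> assume "\<alpha> \<in> R1" "\<beta> \<in> R2" "blinfun_apply \<beta> (coroot \<alpha>) \<noteq> 0"
      then show False using qeq[of \<alpha> \<beta>] by (simp add: R1_def R2_def)
    qed
    ultimately have "\<exists>R1 R2. R1 \<noteq> {} \<and> R2 \<noteq> {} \<and> R1 \<inter> R2 = {} \<and> R1 \<union> R2 = R \<and>
        (\<forall>\<alpha>\<in>R1. \<forall>\<beta>\<in>R2. blinfun_apply \<beta> (coroot \<alpha>) = 0)"
      by (intro exI[of _ R1] exI[of _ R2]) simp
    with irr show False unfolding irreducible_root_system_def by (elim conjE) (rule notE)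
  qed
  \<comment> \<open>Both sides are real-linear in \<beta>, and the roots span the dual space, so the
    identity passes from roots to all covectors, in particular to the coordinate functions.\<close>
  have all: "a u (cvec (root_vector \<beta>)) = q \<alpha>0 * cform \<beta> u" for u \<beta>
  proof -
    have "subspace {\<beta>. a u (cvec (root_vector \<beta>)) = q \<alpha>0 * cform \<beta> u}"
      using smult[of u 0 0]
      by (auto simp: subspace_def root_vector_add root_vector_scaleR root_vector_zero cvec_add cvec_scaleR cvec_zero
          cform_zero_left cform_add_left cform_scaleR_left add smult algebra_simps)
    moreover have "R \<subseteq> {\<beta>. a u (cvec (root_vector \<beta>)) = q \<alpha>0 * cform \<beta> u}"
      using key qconst by auto
    ultimately have "span R \<subseteq> {\<beta>. a u (cvec (root_vector \<beta>)) = q \<alpha>0 * cform \<beta> u}"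
      by (rule span_minimal[rotated])
    then show ?thesis using R by (auto simp: root_system_def)
  qed
  have "a u v = q \<alpha>0 * cdot u v" for u v
  proof -
    have ax: "a u (axis i 1) = q \<alpha>0 * u $ i" for i
    proof -
      have "root_vector (blinfun_inner_left (axis i 1)) = (axis i 1 :: real^'n)"
        by (simp add: root_vector_def vec_eq_iff inner_axis) (simp add: axis_def)
      then show ?thesis using all[of u "blinfun_inner_left (axis i 1)"]
        by (simp add: cvec_axis cform_eq_cdot cdot_commute[of _ u] cdot_axis)
    qed
    have "complex_linear_form (a u)" using bil by (simp add: complex_bilinear_form_def)
    from complex_linear_form_expansion[OF this, of v] show ?thesis
      by (simp add: ax cdot_def sum_distrib_left algebra_simps)
  qed
  then show thesis by (rule that)
qed

section \<open>Reflections permuting the roots, and the sum over roots and coroots\<close>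

lemma root_reflection_involution:
  assumes "root_system R" "\<alpha> \<in> R"
  shows "bij_betw (\<lambda>\<beta>. \<beta> - blinfun_apply \<beta> (coroot \<alpha>) *\<^sub>R \<alpha>) R R"
proof (rule bij_betw_byWitness[where f' = "\<lambda>\<beta>. \<beta> - blinfun_apply \<beta> (coroot \<alpha>) *\<^sub>R \<alpha>"])
  have "blinfun_apply \<alpha> (coroot \<alpha>) = 2"
    using assms by (intro root_coroot) (auto simp: root_system_def)
  then show "\<forall>\<beta>\<in>R. \<beta> - blinfun_apply \<beta> (coroot \<alpha>) *\<^sub>R \<alpha> -
      blinfun_apply (\<beta> - blinfun_apply \<beta> (coroot \<alpha>) *\<^sub>R \<alpha>) (coroot \<alpha>) *\<^sub>R \<alpha> = \<beta>"
    "\<forall>\<beta>\<in>R. \<beta> - blinfun_apply \<beta> (coroot \<alpha>) *\<^sub>R \<alpha> -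
      blinfun_apply (\<beta> - blinfun_apply \<beta> (coroot \<alpha>) *\<^sub>R \<alpha>) (coroot \<alpha>) *\<^sub>R \<alpha> = \<beta>"
    by (simp_all add: blinfun.diff_left blinfun.scaleR_left)
qed (use assms in \<open>auto simp: root_system_def\<close>)

text \<open>Moves the reflection from the vector to the covector, where it permutes the roots and
  can be absorbed by reindexing a sum.\<close>

lemma cform_reflection:
  "cform \<beta> (cmap (reflection \<alpha>) u) = cform (\<beta> - blinfun_apply \<beta> (coroot \<alpha>) *\<^sub>R \<alpha>) u"
proof -
  have "cform (\<beta> - blinfun_apply \<beta> (coroot \<alpha>) *\<^sub>R \<alpha>) u =
      cform (\<beta> + (- blinfun_apply \<beta> (coroot \<alpha>)) *\<^sub>R \<alpha>) u" by simp
  also have "\<dots> = cform \<beta> u - blinfun_apply \<beta> (coroot \<alpha>) * cform \<alpha> u"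
    by (simp only: cform_add_left cform_scaleR_left) simp
  finally show ?thesis
    by (simp add: cmap_reflection cform_diff cform_smult cform_cvec)
qed

lemma root_vector_norm_reflection:
  "root_vector (\<beta> - blinfun_apply \<beta> (coroot \<alpha>) *\<^sub>R \<alpha>) \<bullet> root_vector (\<beta> - blinfun_apply \<beta> (coroot \<alpha>) *\<^sub>R \<alpha>)
    = root_vector \<beta> \<bullet> root_vector \<beta>"
  by (cases "root_vector \<alpha> = 0")
     (simp_all add: root_vector_diff root_vector_scaleR blinfun_apply_root_vector coroot_eq
       inner_diff_left inner_diff_right inner_commute field_simps)

text \<open>Paired with v, the left side is an invariant form in u and v, since reflections permute
  the roots and preserve their lengths; so it is a multiple of \<open>cdot\<close>. The trace
  determines the multiple: every root contributes \<gamma>(\<open>coroot \<gamma>\<close>) = 2, and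
  the trace of the identity is the rank.\<close>

proposition sum_roots_coroots:
  fixes R :: "'n::finite covector set"
  assumes R: "root_system R" and irr: "irreducible_root_system R"
  shows "(\<Sum>\<gamma>\<in>R. cform \<gamma> u *s cvec (coroot \<gamma>)) = of_real (2 * real (card R) / real CARD('n)) *s u"
proof -
  \<comment> \<open>This weight turns the root vector into the coroot.\<close>
  define w where "w \<gamma> = complex_of_real (2 / (root_vector \<gamma> \<bullet> root_vector \<gamma>))" for \<gamma> :: "'n covector"
  define a where "a u v = (\<Sum>\<gamma>\<in>R. w \<gamma> * cform \<gamma> u * cform \<gamma> v)" for u v
  have bil: "complex_bilinear_form a"
    by (auto simp: complex_bilinear_form_def complex_linear_form_iff a_def cform_add cform_smult
       sum.distrib algebra_simps sum_distrib_left)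
  have inv: "a (cmap (reflection \<alpha>) u) (cmap (reflection \<alpha>) v) = a u v" if "\<alpha> \<in> R" for \<alpha> u v
  proof -
    have "a u v = (\<Sum>\<gamma>\<in>R. w (\<gamma> - blinfun_apply \<gamma> (coroot \<alpha>) *\<^sub>R \<alpha>) *
        cform (\<gamma> - blinfun_apply \<gamma> (coroot \<alpha>) *\<^sub>R \<alpha>) u * cform (\<gamma> - blinfun_apply \<gamma> (coroot \<alpha>) *\<^sub>R \<alpha>) v)"
      unfolding a_def by (rule sum.reindex_bij_betw[OF root_reflection_involution[OF R that], symmetric])
    also have "\<dots> = a (cmap (reflection \<alpha>) u) (cmap (reflection \<alpha>) v)"
      unfolding a_def cform_reflection w_def root_vector_norm_reflection ..
    finally show ?thesis by simp
  qed
  obtain c where c: "\<And>u v. a u v = c * cdot u v"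
    by (rule reflection_invariant_form_scalar[OF R irr bil _ inv]) (auto simp: a_def mult_ac)
  \<comment> \<open>The trace of the form over the standard basis, computed in two ways.\<close>
  have "c * of_nat CARD('n) = (\<Sum>i\<in>UNIV. a (axis i 1) (axis i 1))"
    by (simp add: c cdot_axis)
  also have "\<dots> = (\<Sum>\<gamma>\<in>R. w \<gamma> * (\<Sum>i\<in>UNIV. cform \<gamma> (axis i 1) * cform \<gamma> (axis i 1)))"
    unfolding a_def by (subst sum.swap) (simp add: sum_distrib_left mult_ac)
  also have "\<dots> = (\<Sum>\<gamma>\<in>R. 2)"
  proof (rule sum.cong[OF refl])
    fix \<gamma> assume "\<gamma> \<in> R"
    then have "root_vector \<gamma> \<noteq> 0" using R by (auto simp: root_system_def root_vector_eq_0_iff)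
    moreover have "(\<Sum>i\<in>UNIV. cform \<gamma> (axis i 1) * cform \<gamma> (axis i 1)) = of_real (root_vector \<gamma> \<bullet> root_vector \<gamma>)"
      unfolding cform_eq_cdot cdot_axis by (simp add: cdot_cvec[symmetric] cdot_def)
    ultimately show "w \<gamma> * (\<Sum>i\<in>UNIV. cform \<gamma> (axis i 1) * cform \<gamma> (axis i 1)) = 2"
      by (simp add: w_def)
  qed
  finally have c2: "c = of_real (2 * real (card R) / real CARD('n))"
    by (simp add: field_simps)
  have "(\<Sum>\<gamma>\<in>R. cform \<gamma> u *s cvec (coroot \<gamma>)) $ j = a u (axis j 1)" for j
    by (simp add: a_def w_def cform_eq_cdot cdot_axis coroot_eq cvec_def sum_component mult_ac)
  then show ?thesis
    by (simp add: vec_eq_iff c cdot_axis c2)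
qed

section \<open>The torus\<close>

lemma h_part_add: "h_part (u + v) = h_part u + h_part v"
  and h_part_diff: "h_part (u - v) = h_part u - h_part v"
  and h_part_smult: "h_part (c *s u) = c *s h_part u"
  and h_part_zero: "h_part 0 = 0"
  and t_part_add: "t_part (u + v) = t_part u + t_part v"
  and t_part_diff: "t_part (u - v) = t_part u - t_part v"
  and t_part_smult: "t_part (c *s u) = c * t_part u"
  and t_part_zero: "t_part 0 = 0"
  and h_part_join_ht: "h_part (join_ht X c) = X"
  and t_part_join_ht: "t_part (join_ht X c) = c"
  by (simp_all add: h_part_def t_part_def join_ht_def vec_eq_iff)

lemma join_ht_parts: "join_ht (h_part u) (t_part u) = u"
  by (auto simp: join_ht_def h_part_def t_part_def vec_eq_iff split: option.split)

lemma ht_eqI: "h_part u = h_part v \<Longrightarrow> t_part u = t_part v \<Longrightarrow> u = v"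
  by (metis join_ht_parts)

lemma bounded_linear_h_part: "bounded_linear h_part"
  by (auto simp: linear_conv_bounded_linear[symmetric] h_part_def vec_eq_iff intro!: linearI)

lemma bounded_linear_t_part: "bounded_linear t_part"
  by (auto simp: linear_conv_bounded_linear[symmetric] t_part_def intro!: linearI)

lemma bounded_linear_cform: "bounded_linear (cform \<alpha>)"
  by (rule complex_linear_form_bounded_linear) (simp add: complex_linear_form_iff cform_add cform_smult)

text \<open>The kernel of \<open>exp\<close> is generated by 2 pi i; every bound 2 pi below comes
  from here.\<close>

lemma exp_eq_1_small:
  assumes "exp z = 1" "norm (z::complex) < 2 * pi"
  shows "z = 0"
proof -
  from assms(1) obtain n :: int where n: "Re z = 0" "Im z = of_int (2 * n) * pi"
    by (auto simp: exp_eq_1)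
  have "\<bar>Im z\<bar> < 2 * pi" using abs_Im_le_cmod[of z] assms(2) by linarith
  then have "\<bar>real_of_int n\<bar> < 1" by (simp add: n abs_mult)
  then have "n = 0" by linarith
  with n show ?thesis by (simp add: complex_eq_iff)
qed

section \<open>The root lattice and its characters\<close>

lemma root_latticeI:
  fixes m :: "'n::finite covector \<Rightarrow> int"
  shows "q = (\<Sum>\<alpha>\<in>R. of_int (m \<alpha>) *\<^sub>R \<alpha>) \<Longrightarrow> q \<in> root_lattice R"
  by (auto simp: root_lattice_def)

lemma zero_in_root_lattice: "0 \<in> root_lattice R"
  unfolding root_lattice_def by (rule CollectI) (auto intro!: exI[of _ "\<lambda>_. 0"])

lemma add_in_root_lattice:
  assumes "p \<in> root_lattice R" "q \<in> root_lattice R"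
  shows "p + q \<in> root_lattice R"
proof -
  obtain m m' where "p = (\<Sum>\<alpha>\<in>R. of_int (m \<alpha>) *\<^sub>R \<alpha>)" "q = (\<Sum>\<alpha>\<in>R. of_int (m' \<alpha>) *\<^sub>R \<alpha>)"
    using assms by (auto simp: root_lattice_def)
  then have "p + q = (\<Sum>\<alpha>\<in>R. of_int (m \<alpha> + m' \<alpha>) *\<^sub>R \<alpha>)"
    by (simp add: sum.distrib scaleR_add_left)
  then show ?thesis by (rule root_latticeI)
qed

lemma int_multiple_in_root_lattice:
  assumes "p \<in> root_lattice R"
  shows "of_int n *\<^sub>R p \<in> root_lattice R"
proof -
  obtain m where "p = (\<Sum>\<alpha>\<in>R. of_int (m \<alpha>) *\<^sub>R \<alpha>)"
    using assms by (auto simp: root_lattice_def)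
  then have "of_int n *\<^sub>R p = (\<Sum>\<alpha>\<in>R. of_int (n * m \<alpha>) *\<^sub>R \<alpha>)"
    by (simp add: scaleR_sum_right)
  then show ?thesis by (rule root_latticeI)
qed

lemma root_in_root_lattice:
  assumes "finite R" "\<alpha> \<in> R"
  shows "\<alpha> \<in> root_lattice R"
proof -
  have "(\<Sum>\<beta>\<in>R. of_int (of_bool (\<beta> = \<alpha>)) *\<^sub>R \<beta>) = (\<Sum>\<beta>\<in>R. if \<beta> = \<alpha> then \<beta> else 0)"
    by (rule sum.cong) auto
  also have "\<dots> = \<alpha>" using assms by simp
  finally show ?thesis by (intro root_latticeI[where m = "\<lambda>\<beta>. of_bool (\<beta> = \<alpha>)"]) simp
qed

text \<open>Countability lets the torus be embedded into a space of sequences, from which it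
  inherits second countability.\<close>

lemma countable_root_lattice:
  assumes "finite R"
  shows "countable (root_lattice R)"
proof -
  have "root_lattice R \<subseteq> (\<lambda>m. \<Sum>\<alpha>\<in>R. of_int (m \<alpha>) *\<^sub>R \<alpha>) ` (R \<rightarrow>\<^sub>E (UNIV :: int set))"
  proof
    fix q assume "q \<in> root_lattice R"
    then obtain m :: "_ \<Rightarrow> int" where "q = (\<Sum>\<alpha>\<in>R. of_int (m \<alpha>) *\<^sub>R \<alpha>)"
      by (auto simp: root_lattice_def)
    then have "q = (\<Sum>\<alpha>\<in>R. of_int (restrict m R \<alpha>) *\<^sub>R \<alpha>)" by simp
    then show "q \<in> (\<lambda>m. \<Sum>\<alpha>\<in>R. of_int (m \<alpha>) *\<^sub>R \<alpha>) ` (R \<rightarrow>\<^sub>E (UNIV :: int set))"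
      by (intro image_eqI[of _ _ "restrict m R"]) auto
  qed
  moreover have "countable (R \<rightarrow>\<^sub>E (UNIV :: int set))"
    using assms by (intro countable_PiE) auto
  ultimately show ?thesis by (meson countable_image countable_subset)
qed

lemma torus_nonzero: "h \<in> torus R \<Longrightarrow> q \<in> root_lattice R \<Longrightarrow> h q \<noteq> 0"
  and torus_add: "h \<in> torus R \<Longrightarrow> p \<in> root_lattice R \<Longrightarrow> q \<in> root_lattice R \<Longrightarrow> h (p + q) = h p * h q"
  by (auto simp: torus_def)

lemma torus_zero: "h \<in> torus R \<Longrightarrow> h 0 = 1"
  using torus_add[of h R 0 0] torus_nonzero[of h R 0] zero_in_root_lattice[of R] by simp

lemma torus_int_multiple:
  assumes h: "h \<in> torus R" and p: "p \<in> root_lattice R"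
  shows "h (of_int n *\<^sub>R p) = h p powi n"
proof (induction n rule: int_induct[where k = 0])
  case base
  then show ?case using torus_zero[OF h] by simp
next
  case (step1 i)
  have "h (of_int (i + 1) *\<^sub>R p) = h (of_int i *\<^sub>R p) * h p"
    using torus_add[OF h int_multiple_in_root_lattice[OF p, of i] p] by (simp add: scaleR_add_left)
  then show ?case using step1 torus_nonzero[OF h p] by (simp add: power_int_add)
next
  case (step2 i)
  have "h (of_int i *\<^sub>R p) = h (of_int (i - 1) *\<^sub>R p) * h p"
    using torus_add[OF h int_multiple_in_root_lattice[OF p, of "i - 1"] p] by (simp add: scaleR_diff_left)
  then show ?case using step2 torus_nonzero[OF h p] by (simp add: power_int_diff field_simps)
qed

lemma torus_sum:
  assumes h: "h \<in> torus R" and R: "finite R"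
  shows "h (\<Sum>\<alpha>\<in>R. of_int (m \<alpha>) *\<^sub>R \<alpha>) = (\<Prod>\<alpha>\<in>R. h \<alpha> powi m \<alpha>)"
proof -
  \<comment> \<open>Lattice membership is carried along in the induction because multiplicativity of
    \<open>h\<close> holds on the lattice only.\<close>
  have "A \<subseteq> R \<Longrightarrow> (\<Sum>\<alpha>\<in>A. of_int (m \<alpha>) *\<^sub>R \<alpha>) \<in> root_lattice R \<and>
      h (\<Sum>\<alpha>\<in>A. of_int (m \<alpha>) *\<^sub>R \<alpha>) = (\<Prod>\<alpha>\<in>A. h \<alpha> powi m \<alpha>)" if "finite A" for A
    using that
  proof induction
    case empty
    then show ?case using torus_zero[OF h] zero_in_root_lattice by simp
  next
    case (insert \<alpha> A)
    then have \<alpha>: "\<alpha> \<in> root_lattice R" using root_in_root_lattice[OF R] by auto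
    show ?case
      using insert int_multiple_in_root_lattice[OF \<alpha>, of "m \<alpha>"]
      by (simp add: add_in_root_lattice torus_add[OF h] torus_int_multiple[OF h \<alpha>])
  qed
  then show ?thesis using R by blast
qed

section \<open>Exponential parametrizations and their local inverses\<close>

text \<open>The parametrizations are studied on the whole torus, since translation by an exponential
  may carry a regular point onto a hypertorus; the regular part is an open subset brought in
  afterwards.\<close>

lemma toric_param_in:
  assumes "p \<in> torus R \<times> (UNIV - {0})"
  shows "toric_param R p x \<in> torus R \<times> (UNIV - {0})"
  using assms by (auto simp: toric_param_def torus_def add_in_root_lattice cform_add_left exp_add)

text \<open>Lets the base point be moved: a question near \<open>x\<close> becomes one near 0, with
  the image of \<open>x\<close> as the new base point.\<close>

lemma toric_param_add:
  "toric_param R (toric_param R p x) y = toric_param R p (x + y)"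
  by (auto simp: toric_param_def h_part_add t_part_add cform_add exp_add)

lemma toric_param_zero:
  assumes "p \<in> torus R \<times> (UNIV - {0})"
  shows "toric_param R p 0 = p"
  using assms by (auto simp: toric_param_def h_part_zero t_part_zero cform_zero torus_def extensional_restrict)

lemma continuous_on_toric_param: "continuous_on A (toric_param R p)"
proof -
  have 1: "continuous_on A (\<lambda>x. cform q (h_part x))" for q
    by (intro bounded_linear.continuous_on[OF bounded_linear_cform] bounded_linear.continuous_on[OF bounded_linear_h_part] continuous_on_id)
  have 2: "continuous_on A t_part"
    by (rule bounded_linear.continuous_on[OF bounded_linear_t_part continuous_on_id])
  have 3: "continuous_on A (\<lambda>x. if q \<in> root_lattice R then fst p q * exp (cform q (h_part x)) else undefined)" for q
    by (cases "q \<in> root_lattice R") (auto intro!: continuous_intros 1)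
  show ?thesis
    unfolding toric_param_def restrict_def
    by (intro continuous_on_Pair continuous_on_coordinatewise_then_product 3 continuous_intros 2)
qed

text \<open>The inverse of the parametrization near \<open>p0\<close>. The factor n/(2|R|) undoes
  the scalar of \<open>sum_roots_coroots\<close>, which recovers a vector of the Lie algebra from
  its values on all roots, here replaced by principal logarithms.\<close>

definition toric_log :: "'n::finite covector set \<Rightarrow> 'n toric_point \<Rightarrow> 'n toric_point \<Rightarrow> complex^('n option)" where
  "toric_log R p0 p =
     join_ht (of_real (real CARD('n) / (2 * real (card R))) *s
       (\<Sum>\<gamma>\<in>R. Ln (fst p \<gamma> / fst p0 \<gamma>) *s cvec (coroot \<gamma>))) (Ln (snd p / snd p0))"

lemma tendsto_fst_coordinate:
  fixes p0 :: "('a \<Rightarrow> complex) \<times> 'b::topological_space"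
  shows "((\<lambda>p. fst p \<gamma>) \<longlongrightarrow> fst p0 \<gamma>) (nhds p0)"
proof -
  have "continuous_on UNIV (\<lambda>p :: ('a \<Rightarrow> complex) \<times> 'b. fst p \<gamma>)"
    by (rule continuous_on_compose2[OF continuous_on_product_coordinates]) (auto intro: continuous_intros)
  then have "((\<lambda>p. fst p \<gamma>) \<longlongrightarrow> fst p0 \<gamma>) (at p0)"
    unfolding continuous_on_def by (rule bspec) simp
  then show ?thesis by (rule iffD1[OF tendsto_at_iff_tendsto_nhds])
qed

lemma tendsto_torus_log:
  fixes p0 :: "'n::finite toric_point"
  assumes "p0 \<in> torus R \<times> (UNIV - {0})" "finite R" "\<gamma> \<in> R"
  shows "((\<lambda>p. Ln (fst p \<gamma> / fst p0 \<gamma>)) \<longlongrightarrow> 0) (nhds p0)"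
proof -
  have nz: "fst p0 \<gamma> \<noteq> 0" using assms torus_nonzero[OF _ root_in_root_lattice[OF assms(2,3)]] by auto
  have "((\<lambda>p. fst p \<gamma> / fst p0 \<gamma>) \<longlongrightarrow> fst p0 \<gamma> / fst p0 \<gamma>) (nhds p0)"
    by (intro tendsto_intros tendsto_fst_coordinate nz)
  then have "((\<lambda>p. Ln (fst p \<gamma> / fst p0 \<gamma>)) \<longlongrightarrow> Ln (fst p0 \<gamma> / fst p0 \<gamma>)) (nhds p0)"
    by (rule tendsto_Ln) (use nz in auto)
  then show ?thesis using nz by simp
qed

lemma tendsto_toric_log:
  fixes p0 :: "'n::finite toric_point"
  assumes p0: "p0 \<in> torus R \<times> (UNIV - {0})" and R: "finite R"
  shows "(toric_log R p0 \<longlongrightarrow> 0) (nhds p0)"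
proof (rule vec_tendstoI)
  fix i :: "'n option"
  have s: "snd p0 \<noteq> 0" using p0 by auto
  have "((\<lambda>p :: 'n toric_point. snd p / snd p0) \<longlongrightarrow> snd p0 / snd p0) (nhds p0)"
    by (intro tendsto_intros filterlim_ident s)
  then have t: "((\<lambda>p :: 'n toric_point. Ln (snd p / snd p0)) \<longlongrightarrow> Ln (snd p0 / snd p0)) (nhds p0)"
    by (rule tendsto_Ln) (use s in auto)
  show "((\<lambda>p. toric_log R p0 p $ i) \<longlongrightarrow> 0 $ i) (nhds p0)"
  proof (cases i)
    case None
    then show ?thesis using t s by (simp add: toric_log_def join_ht_def)
  next
    case (Some j)
    have "((\<lambda>p. of_real (real CARD('n) / (2 * real (card R))) *
        (\<Sum>\<gamma>\<in>R. Ln (fst p \<gamma> / fst p0 \<gamma>) * cvec (coroot \<gamma>) $ j)) \<longlongrightarrow>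
        of_real (real CARD('n) / (2 * real (card R))) * (\<Sum>\<gamma>\<in>R. 0 * cvec (coroot \<gamma>) $ j)) (nhds p0)"
      by (intro tendsto_intros tendsto_torus_log[OF p0 R])
    with Some show ?thesis by (simp add: toric_log_def join_ht_def)
  qed
qed

text \<open>Each root satisfies the integral relation \<open>n \<Sum>\<^sub>\<gamma> \<beta>(\<gamma>\<^sup>\<or>) \<gamma> = 2 |R| \<beta>\<close>.  It makes the small
  logarithms of a homomorphism near \<open>1\<close> the values of one vector of \<open>\<hh>\<close> on the roots, without a
  choice of a basis of the root lattice.\<close>

lemma toric_param_toric_log:
  fixes p0 p :: "'n::finite toric_point"
  assumes R: "root_system R" and irr: "irreducible_root_system R"
    and p0: "p0 \<in> torus R \<times> (UNIV - {0})" and p: "p \<in> torus R \<times> (UNIV - {0})"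
    and small: "\<And>\<beta>. \<beta> \<in> R \<Longrightarrow> norm (of_nat CARD('n) * (\<Sum>\<gamma>\<in>R. of_real (blinfun_apply \<beta> (coroot \<gamma>)) * Ln (fst p \<gamma> / fst p0 \<gamma>))
        - of_nat (2 * card R) * Ln (fst p \<beta> / fst p0 \<beta>)) < 2 * pi"
  shows "toric_param R p0 (toric_log R p0 p) = p"
proof -
  have fin: "finite R" using R by (simp add: root_system_def)
  have "R \<noteq> {}" using irr unfolding irreducible_root_system_def by (rule conjunct1)
  then have card: "card R > 0" using fin by (simp add: card_gt_0_iff)
  define l where "l \<gamma> = Ln (fst p \<gamma> / fst p0 \<gamma>)" for \<gamma>
  define X where "X = h_part (toric_log R p0 p)"
  have h0: "fst p0 \<in> torus R" and h: "fst p \<in> torus R" using p0 p by auto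
  have nz0: "fst p0 \<gamma> \<noteq> 0" and nz: "fst p \<gamma> \<noteq> 0" if "\<gamma> \<in> R" for \<gamma>
    using that h0 h torus_nonzero root_in_root_lattice[OF fin] by blast+
  have expl: "exp (of_int m * l \<gamma>) = (fst p \<gamma> / fst p0 \<gamma>) powi m" if "\<gamma> \<in> R" for \<gamma> m
    using nz0[OF that] nz[OF that] by (simp add: l_def exp_power_int[symmetric])
  have exp_lat: "exp (\<Sum>\<gamma>\<in>R. of_int (m \<gamma>) * l \<gamma>) =
      fst p (\<Sum>\<gamma>\<in>R. of_int (m \<gamma>) *\<^sub>R \<gamma>) / fst p0 (\<Sum>\<gamma>\<in>R. of_int (m \<gamma>) *\<^sub>R \<gamma>)" for m
    using fin by (simp add: exp_sum expl torus_sum[OF h] torus_sum[OF h0] power_int_divide_distrib prod_dividef)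
  have X: "cform \<beta> X = l \<beta>" if \<beta>: "\<beta> \<in> R" for \<beta>
  proof -
    have "\<exists>z::int. blinfun_apply \<beta> (coroot \<gamma>) = of_int z" if "\<gamma> \<in> R" for \<gamma>
    proof -
      have "blinfun_apply \<beta> (coroot \<gamma>) \<in> \<int>" using R \<beta> that by (simp add: root_system_def)
      then show ?thesis by (auto elim: Ints_cases)
    qed
    then obtain z :: "'n covector \<Rightarrow> int" where z: "\<And>\<gamma>. \<gamma> \<in> R \<Longrightarrow> blinfun_apply \<beta> (coroot \<gamma>) = of_int (z \<gamma>)"
      by metis
    \<comment> \<open>The coefficients of the relation, with the multiple of \<beta> brought to the
      same side; they are integers because \<open>z\<close> collects the values of \<beta> on
      coroots.\<close>
    define m where "m \<gamma> = int CARD('n) * z \<gamma> - (if \<gamma> = \<beta> then 2 * int (card R) else 0)" for \<gamma>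
    have split: "(\<Sum>\<gamma>\<in>R. of_int (m \<gamma>) * f \<gamma>) =
       of_nat CARD('n) * (\<Sum>\<gamma>\<in>R. of_real (blinfun_apply \<beta> (coroot \<gamma>)) * f \<gamma>) - of_nat (2 * card R) * f \<beta>"
      for f :: "'n covector \<Rightarrow> complex"
    proof -
      have "(\<Sum>\<gamma>\<in>R. of_int (m \<gamma>) * f \<gamma>) = (\<Sum>\<gamma>\<in>R. of_nat CARD('n) * (of_real (blinfun_apply \<beta> (coroot \<gamma>)) * f \<gamma>) -
          (if \<gamma> = \<beta> then of_nat (2 * card R) * f \<gamma> else 0))"
        by (rule sum.cong) (auto simp: m_def z algebra_simps)
      also have "\<dots> = of_nat CARD('n) * (\<Sum>\<gamma>\<in>R. of_real (blinfun_apply \<beta> (coroot \<gamma>)) * f \<gamma>) - of_nat (2 * card R) * f \<beta>"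
        using fin \<beta> by (simp add: sum_subtractf sum_distrib_left)
      finally show ?thesis .
    qed
    have "cform \<beta> (\<Sum>\<gamma>\<in>R. cform \<gamma> u *s cvec (coroot \<gamma>)) = cform \<beta> (of_real (2 * real (card R) / real CARD('n)) *s u)" for u
      by (simp add: sum_roots_coroots[OF R irr])
    then have "of_nat CARD('n) * (\<Sum>\<gamma>\<in>R. of_real (blinfun_apply \<beta> (coroot \<gamma>)) * cform \<gamma> u) = of_nat (2 * card R) * cform \<beta> u" for u
      by (simp add: cform_sum cform_smult cform_cvec mult.commute)
    then have "cform (\<Sum>\<gamma>\<in>R. of_int (m \<gamma>) *\<^sub>R \<gamma>) u = 0" for u
      using split[of "\<lambda>\<gamma>. cform \<gamma> u"] by (simp add: cform_sum_left cform_scaleR_left)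
    then have "of_real (blinfun_apply (\<Sum>\<gamma>\<in>R. of_int (m \<gamma>) *\<^sub>R \<gamma>) v) = (0 :: complex)" for v
      by (metis cform_cvec)
    then have "(\<Sum>\<gamma>\<in>R. of_int (m \<gamma>) *\<^sub>R \<gamma>) = 0"
      by (intro blinfun_eqI) simp
    \<comment> \<open>Homomorphisms send the relation to 1, so the combination of logarithms is a
      multiple of 2 pi i; the bound \<open>small\<close> leaves only 0.\<close>
    then have "exp (\<Sum>\<gamma>\<in>R. of_int (m \<gamma>) * l \<gamma>) = 1"
      using torus_zero[OF h] torus_zero[OF h0] by (simp add: exp_lat)
    moreover have "norm (\<Sum>\<gamma>\<in>R. of_int (m \<gamma>) * l \<gamma>) < 2 * pi"
      using small[OF \<beta>] by (simp add: split l_def)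
    ultimately have "(\<Sum>\<gamma>\<in>R. of_int (m \<gamma>) * l \<gamma>) = 0"
      by (rule exp_eq_1_small)
    then have "of_nat CARD('n) * (\<Sum>\<gamma>\<in>R. of_real (blinfun_apply \<beta> (coroot \<gamma>)) * l \<gamma>) = of_nat (2 * card R) * l \<beta>"
      by (simp add: split)
    moreover have "cform \<beta> X = of_nat CARD('n) / (2 * of_nat (card R)) * (\<Sum>\<gamma>\<in>R. of_real (blinfun_apply \<beta> (coroot \<gamma>)) * l \<gamma>)"
      by (simp add: X_def toric_log_def h_part_join_ht cform_smult cform_sum cform_cvec l_def mult.commute)
    ultimately show ?thesis using card by (simp add: field_simps)
  qed
  have "fst p0 q * exp (cform q X) = fst p q" if L: "q \<in> root_lattice R" for q
  proof -
    obtain m :: "'n covector \<Rightarrow> int" where q: "q = (\<Sum>\<alpha>\<in>R. of_int (m \<alpha>) *\<^sub>R \<alpha>)"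
      using L by (auto simp: root_lattice_def)
    have "cform q X = (\<Sum>\<gamma>\<in>R. of_int (m \<gamma>) * l \<gamma>)"
      by (simp add: q cform_sum_left cform_scaleR_left X)
    then have "exp (cform q X) = fst p q / fst p0 q" by (simp add: exp_lat q)
    then show ?thesis using torus_nonzero[OF h0 L] by simp
  qed
  then have "fst (toric_param R p0 (toric_log R p0 p)) = fst p"
    using h by (auto simp: toric_param_def X_def[symmetric] torus_def extensional_def fun_eq_iff)
  moreover have "snd p \<noteq> 0" "snd p0 \<noteq> 0" using p p0 by auto
  then have "snd (toric_param R p0 (toric_log R p0 p)) = snd p"
    by (simp add: toric_param_def toric_log_def t_part_join_ht)
  ultimately show ?thesis by (simp add: prod_eq_iff)
qed

text \<open>Near \<open>p0\<close> the logarithm lies in \<open>W\<close>, and the combinations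
  bounded in \<open>toric_param_toric_log\<close> tend to 0; as there are finitely many roots, all
  bounds hold on one neighbourhood.\<close>

lemma eventually_in_toric_param_image:
  fixes p0 :: "'n::finite toric_point"
  assumes R: "root_system R" and irr: "irreducible_root_system R"
    and p0: "p0 \<in> torus R \<times> (UNIV - {0})" and W: "open W" "0 \<in> W"
  shows "\<forall>\<^sub>F p in nhds p0. p \<in> torus R \<times> (UNIV - {0}) \<longrightarrow> p \<in> toric_param R p0 ` W"
proof -
  have fin: "finite R" using R by (simp add: root_system_def)
  have 1: "\<forall>\<^sub>F p in nhds p0. toric_log R p0 p \<in> W"
    by (rule topological_tendstoD[OF tendsto_toric_log[OF p0 fin] W])
  have "\<forall>\<^sub>F p in nhds p0. norm (of_nat CARD('n) * (\<Sum>\<gamma>\<in>R. of_real (blinfun_apply \<beta> (coroot \<gamma>)) * Ln (fst p \<gamma> / fst p0 \<gamma>))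
        - of_nat (2 * card R) * Ln (fst p \<beta> / fst p0 \<beta>)) < 2 * pi" if "\<beta> \<in> R" for \<beta>
  proof -
    have "((\<lambda>p. norm (of_nat CARD('n) * (\<Sum>\<gamma>\<in>R. of_real (blinfun_apply \<beta> (coroot \<gamma>)) * Ln (fst p \<gamma> / fst p0 \<gamma>))
        - of_nat (2 * card R) * Ln (fst p \<beta> / fst p0 \<beta>))) \<longlongrightarrow>
        norm (of_nat CARD('n) * (\<Sum>\<gamma>\<in>R. of_real (blinfun_apply \<beta> (coroot \<gamma>)) * 0) - of_nat (2 * card R) * (0::complex))) (nhds p0)"
      by (intro tendsto_intros tendsto_torus_log[OF p0 fin] that)
    then show ?thesis by (rule order_tendstoD(2)) simp
  qed
  then have 2: "\<forall>\<^sub>F p in nhds p0. \<forall>\<beta>\<in>R. norm (of_nat CARD('n) * (\<Sum>\<gamma>\<in>R. of_real (blinfun_apply \<beta> (coroot \<gamma>)) * Ln (fst p \<gamma> / fst p0 \<gamma>))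
        - of_nat (2 * card R) * Ln (fst p \<beta> / fst p0 \<beta>)) < 2 * pi"
    by (simp add: eventually_ball_finite_distrib[OF fin])
  show ?thesis
    using 1 2
  proof eventually_elim
    case (elim p)
    show ?case
    proof
      assume "p \<in> torus R \<times> (UNIV - {0})"
      then have "p = toric_param R p0 (toric_log R p0 p)"
        using elim(2) by (intro toric_param_toric_log[OF R irr p0, symmetric]) auto
      then show "p \<in> toric_param R p0 ` W" using elim(1) by (rule image_eqI)
    qed
  qed
qed

proposition openin_toric_param_image:
  fixes p0 :: "'n::finite toric_point"
  assumes R: "root_system R" and irr: "irreducible_root_system R"
    and p0: "p0 \<in> torus R \<times> (UNIV - {0})" and W: "open W"
  shows "openin (top_of_set (torus R \<times> (UNIV - {0}))) (toric_param R p0 ` W)"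
proof (subst openin_subopen, rule ballI)
  fix p assume "p \<in> toric_param R p0 ` W"
  then obtain x where x: "x \<in> W" "p = toric_param R p0 x" by auto
  have p: "p \<in> torus R \<times> (UNIV - {0})" using toric_param_in[OF p0] x by simp
  \<comment> \<open>The base point moves to the given image point, so that only neighbourhoods of 0
    have to be treated.\<close>
  have "open ((\<lambda>y. y - x) ` W)" using W by (rule open_translation_subtract)
  moreover have "0 \<in> (\<lambda>y. y - x) ` W" using x by auto
  ultimately have "\<forall>\<^sub>F q in nhds p. q \<in> torus R \<times> (UNIV - {0}) \<longrightarrow> q \<in> toric_param R p ` (\<lambda>y. y - x) ` W"
    by (rule eventually_in_toric_param_image[OF R irr p])
  moreover have "toric_param R p ` (\<lambda>y. y - x) ` W = toric_param R p0 ` W"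
    by (simp add: image_image x(2) toric_param_add)
  ultimately obtain N where N: "open N" "p \<in> N" "\<And>q. q \<in> N \<Longrightarrow> q \<in> torus R \<times> (UNIV - {0}) \<Longrightarrow> q \<in> toric_param R p0 ` W"
    by (auto simp: eventually_nhds)
  show "\<exists>T. openin (top_of_set (torus R \<times> (UNIV - {0}))) T \<and> p \<in> T \<and> T \<subseteq> toric_param R p0 ` W"
    by (intro exI[of _ "(torus R \<times> (UNIV - {0})) \<inter> N"] conjI openin_open_Int) (use N p in auto)
qed

text \<open>The condition bears on the difference \<open>x - y\<close> alone, so one
  \<open>W\<close> gives injectivity on every translate of a small ball.\<close>

lemma toric_param_locally_injective:
  fixes p :: "'n::finite toric_point"
  assumes R: "root_system R" and irr: "irreducible_root_system R"
    and p: "p \<in> torus R \<times> (UNIV - {0})"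
  obtains W where "open W" "0 \<in> W"
    "\<And>x y. toric_param R p x = toric_param R p y \<Longrightarrow> x - y \<in> W \<Longrightarrow> x = y"
proof -
  have fin: "finite R" using R by (simp add: root_system_def)
  have "R \<noteq> {}" using irr unfolding irreducible_root_system_def by (rule conjunct1)
  then have card: "card R > 0" using fin by (simp add: card_gt_0_iff)
  define W :: "(complex^('n option)) set"
    where "W = (\<Inter>\<beta>\<in>R. {u. norm (cform \<beta> (h_part u)) < 2 * pi}) \<inter> {u. norm (t_part u) < 2 * pi}"
  show thesis
  proof (rule that[of W])
    have "open {u :: complex^('n option). norm (cform \<beta> (h_part u)) < 2 * pi}" for \<beta>
      by (intro open_Collect_less continuous_intros bounded_linear.continuous_on[OF bounded_linear_cform]
          bounded_linear.continuous_on[OF bounded_linear_h_part])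
    moreover have "open {u :: complex^('n option). norm (t_part u) < 2 * pi}"
      by (intro open_Collect_less continuous_intros bounded_linear.continuous_on[OF bounded_linear_t_part])
    ultimately show "open W" unfolding W_def using fin by (intro open_Int open_INT) auto
    show "0 \<in> W" by (simp add: W_def h_part_zero t_part_zero cform_zero)
    fix x y assume eq: "toric_param R p x = toric_param R p y" and W: "x - y \<in> W"
    have "cform \<beta> (h_part (x - y)) = 0" if \<beta>: "\<beta> \<in> R" for \<beta>
    proof (rule exp_eq_1_small)
      have L: "\<beta> \<in> root_lattice R" by (rule root_in_root_lattice[OF fin \<beta>])
      have "fst (toric_param R p x) \<beta> = fst (toric_param R p y) \<beta>" using eq by simp
      then have "exp (cform \<beta> (h_part x)) = exp (cform \<beta> (h_part y))"
        using L p torus_nonzero[of "fst p" R \<beta>] by (auto simp: toric_param_def)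
      then show "exp (cform \<beta> (h_part (x - y))) = 1"
        by (simp add: h_part_diff cform_diff exp_diff)
      show "norm (cform \<beta> (h_part (x - y))) < 2 * pi" using W \<beta> by (auto simp: W_def)
    qed
    \<comment> \<open>A vector annihilated by all roots is 0, because the sum over roots and coroots
      recovers it up to a nonzero factor.\<close>
    then have "of_real (2 * real (card R) / real CARD('n)) *s h_part (x - y) = 0"
      unfolding sum_roots_coroots[OF R irr, symmetric] by simp
    then have "h_part (x - y) = 0" using card by (simp add: vec_eq_iff)
    moreover have "t_part (x - y) = 0"
    proof (rule exp_eq_1_small)
      have "exp (t_part x) = exp (t_part y)" using eq p by (auto simp: toric_param_def)
      then show "exp (t_part (x - y)) = 1" by (simp add: t_part_diff exp_diff)
      show "norm (t_part (x - y)) < 2 * pi" using W by (simp add: W_def)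
    qed
    ultimately show "x = y" by (intro ht_eqI) (auto simp: h_part_diff t_part_diff)
  qed
qed

text \<open>The space of functions on all covectors has an uncountable index set and is not second
  countable. A point of the torus is determined by its values on the countable root lattice, so an
  enumeration of the lattice turns points into sequences.\<close>

lemma torus_homeomorphic_sequences:
  fixes R :: "'n::finite covector set"
  assumes "finite R" and S: "S \<subseteq> torus R \<times> (UNIV :: complex set)"
  obtains S' :: "((nat \<Rightarrow> complex) \<times> complex) set" where "top_of_set S homeomorphic_space top_of_set S'"
proof -
  define L where "L = root_lattice R"
  have "countable L" "L \<noteq> {}"
    using countable_root_lattice[OF assms(1)] zero_in_root_lattice by (auto simp: L_def)
  define f where "f p = ((\<lambda>n. fst p (from_nat_into L n)), snd p)" for p :: "'n toric_point"
  define g where "g p = ((\<lambda>q\<in>L. fst p (to_nat_on L q)), snd p)" for p :: "(nat \<Rightarrow> complex) \<times> complex"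
  have coord: "continuous_on A (\<lambda>p. fst p i)" for A :: "(('b \<Rightarrow> complex) \<times> complex) set" and i
    by (rule continuous_on_compose2[OF continuous_on_product_coordinates]) (auto intro: continuous_intros)
  have f: "continuous_on S f"
    unfolding f_def by (intro continuous_on_Pair continuous_on_coordinatewise_then_product coord continuous_intros)
  have "continuous_on A (\<lambda>p. if q \<in> L then fst p (to_nat_on L q) else undefined)" for A :: "((nat \<Rightarrow> complex) \<times> complex) set" and q
    by (cases "q \<in> L") (auto intro: coord)
  then have g: "continuous_on (f ` S) g"
    unfolding g_def restrict_def
    by (intro continuous_on_Pair continuous_on_coordinatewise_then_product continuous_intros)
  have gf: "g (f p) = p" if "p \<in> S" for p
  proof -
    \<comment> \<open>Off the lattice every point of the torus has the default value, which the
      restriction in \<open>g\<close> restores.\<close>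
    have "fst p \<in> extensional L" using that S by (auto simp: torus_def L_def)
    then show ?thesis using \<open>countable L\<close>
      by (auto simp: f_def g_def prod_eq_iff fun_eq_iff extensional_def)
  qed
  have "homeomorphic_maps (top_of_set S) (top_of_set (f ` S)) f g"
    unfolding homeomorphic_maps_def using f g gf
    by (auto simp: continuous_map_in_subtopology)
  then show thesis using that[of "f ` S"] by (auto simp: homeomorphic_space_def)
qed

section \<open>Charts, transition maps and the manifold structure\<close>

lemma toric_space_subset: "toric_space R P \<subseteq> torus R \<times> (UNIV - {0})"
  by (auto simp: toric_space_def torus_regular_def)

lemma toric_chartE:
  assumes "c \<in> toric_atlas R P"
  obtains p U where "p \<in> torus R \<times> (UNIV - {0})" "open U" "inj_on (toric_param R p) U"
    "toric_param R p ` U \<subseteq> toric_space R P" "fst c = toric_param R p ` U" "chart_image c = U"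
    "\<forall>x\<in>U. chart_inv c x = toric_param R p x" "\<forall>x\<in>U. snd c (toric_param R p x) = x"
proof -
  obtain p U where c: "c = (toric_param R p ` U, inv_into U (toric_param R p))"
    and p: "p \<in> toric_space R P" and U: "open U" "inj_on (toric_param R p) U" "toric_param R p ` U \<subseteq> toric_space R P"
    using assms by (auto simp: toric_atlas_def)
  have inv: "snd c (toric_param R p x) = x" if "x \<in> U" for x
    using U(2) that by (simp add: c)
  have im: "chart_image c = U"
    using inv by (force simp: chart_image_def c)
  have "chart_inv c x = toric_param R p x" if "x \<in> U" for x
  proof -
    have "inj_on (snd c) (fst c)" by (simp add: c inj_on_inv_into)
    from inv_into_f_f[OF this, of "toric_param R p x"] show ?thesis
      using that inv[OF that] by (simp add: chart_inv_def c)
  qed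
  moreover have "p \<in> torus R \<times> (UNIV - {0})" using p toric_space_subset by blast
  ultimately show thesis using that[of p U] U inv im by (simp add: c)
qed

lemma openin_toric_space_param_image:
  fixes p :: "'n::finite toric_point"
  assumes R: "root_system R" and irr: "irreducible_root_system R"
    and p: "p \<in> torus R \<times> (UNIV - {0})" and W: "open W" "toric_param R p ` W \<subseteq> toric_space R P"
  shows "openin (top_of_set (toric_space R P)) (toric_param R p ` W)"
proof -
  have "openin (top_of_set (torus R \<times> (UNIV - {0}))) (toric_param R p ` W)"
    by (rule openin_toric_param_image[OF R irr p W(1)])
  then show ?thesis by (rule openin_subset_trans[OF _ W(2) toric_space_subset])
qed

text \<open>If \<open>x0\<close> and \<open>y0\<close> name the same point in two charts, then so do
  \<open>x\<close> and \<open>y0 + (x - x0)\<close>, both parametrizations being exponential; local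
  injectivity makes the latter the coordinate in the second chart. The vector \<open>v\<close> is
  only locally constant: periods of the exponential can change it between components of the
  overlap.\<close>

proposition toric_transition_translation:
  fixes c d :: "('n::finite toric_point, 'n option) chart"
  assumes R: "root_system R" and irr: "irreducible_root_system R"
    and c: "c \<in> toric_atlas R P" and d: "d \<in> toric_atlas R P"
    and x0: "x0 \<in> snd c ` (fst c \<inter> fst d)"
  obtains N v where "open N" "x0 \<in> N" "\<And>x. x \<in> N \<Longrightarrow> (snd d \<circ> chart_inv c) x = x + v"
proof -
  obtain p U where p: "p \<in> torus R \<times> (UNIV - {0})" "open U" "inj_on (toric_param R p) U"
    "toric_param R p ` U \<subseteq> toric_space R P" "fst c = toric_param R p ` U" "chart_image c = U"
    "\<forall>x\<in>U. chart_inv c x = toric_param R p x" "\<forall>x\<in>U. snd c (toric_param R p x) = x"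
    by (rule toric_chartE[OF c]) (rule that)
  obtain p' U' where p': "p' \<in> torus R \<times> (UNIV - {0})" "open U'" "inj_on (toric_param R p') U'"
    "toric_param R p' ` U' \<subseteq> toric_space R P" "fst d = toric_param R p' ` U'" "chart_image d = U'"
    "\<forall>x\<in>U'. chart_inv d x = toric_param R p' x" "\<forall>x\<in>U'. snd d (toric_param R p' x) = x"
    by (rule toric_chartE[OF d]) (rule that)
  obtain y0 where x0U: "x0 \<in> U" and y0: "y0 \<in> U'" and eq0: "toric_param R p x0 = toric_param R p' y0"
    using x0 p(5,8) p'(5) by auto
  obtain W where W: "open W" "0 \<in> W"
    "\<And>x y. toric_param R p' x = toric_param R p' y \<Longrightarrow> x - y \<in> W \<Longrightarrow> x = y"
    using toric_param_locally_injective[OF R irr p'(1)] by blast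
  obtain e where e: "e > 0" "ball 0 e \<subseteq> W" using W by (meson open_contains_ball)
  \<comment> \<open>Two balls of radius \<open>e/2\<close> keep the difference of the candidate
    coordinates below \<open>e\<close>, hence in \<open>W\<close>. That \<open>N\<close> is open
    uses continuity of one parametrization and openness of the other.\<close>
  define N where "N = (U \<inter> toric_param R p -` (toric_param R p' ` (U' \<inter> ball y0 (e/2)))) \<inter> ball x0 (e/2)"
  have "openin (top_of_set U) (U \<inter> toric_param R p -` (toric_param R p' ` (U' \<inter> ball y0 (e/2))))"
    by (rule continuous_openin_preimage[OF continuous_on_toric_param _ openin_toric_param_image[OF R irr p'(1)]])
       (use p'(2) toric_param_in[OF p(1)] in auto)
  then have "open N"
    unfolding N_def using p(2) by (intro open_Int[OF openin_open_trans open_ball])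
  moreover have "x0 \<in> N" using x0U y0 eq0 e by (auto simp: N_def)
  moreover have "(snd d \<circ> chart_inv c) x = x + (y0 - x0)" if x: "x \<in> N" for x
  proof -
    obtain y where y: "y \<in> U'" "dist y0 y < e/2" "toric_param R p x = toric_param R p' y" and xU: "x \<in> U" "dist x0 x < e/2"
      using x by (auto simp: N_def)
    have "toric_param R p' (y0 + (x - x0)) = toric_param R p (x0 + (x - x0))"
      by (simp only: toric_param_add[symmetric] eq0)
    then have "toric_param R p' y = toric_param R p' (y0 + (x - x0))" using y(3) by simp
    moreover have "y - (y0 + (x - x0)) \<in> W"
    proof -
      have "norm ((y - y0) - (x - x0)) < e"
        using y(2) xU(2) norm_triangle_ineq4[of "y - y0" "x - x0"] by (simp add: dist_norm norm_minus_commute)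
      moreover have "y - (y0 + (x - x0)) = (y - y0) - (x - x0)" by (simp add: algebra_simps)
      ultimately have "y - (y0 + (x - x0)) \<in> ball 0 e" by (simp only: mem_ball_0)
      then show ?thesis using e by blast
    qed
    ultimately have "y = y0 + (x - x0)" by (rule W(3))
    then show ?thesis using p(7)[THEN bspec, OF xU(1)] p'(8)[THEN bspec, OF y(1)] y(3) by simp
  qed
  ultimately show thesis by (rule that)
qed

text \<open>Identity Jacobians make the transition maps holomorphic and justify coordinate
  expressions of the product, the form and the unit that ignore the chart.\<close>

lemma toric_transition_has_derivative:
  fixes c d :: "('n::finite toric_point, 'n option) chart"
  assumes "root_system R" "irreducible_root_system R"
    "c \<in> toric_atlas R P" "d \<in> toric_atlas R P" "x0 \<in> snd c ` (fst c \<inter> fst d)"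
  shows "((snd d \<circ> chart_inv c) has_derivative (\<lambda>u. u)) (at x0)"
proof -
  obtain N v where N: "open N" "x0 \<in> N" "\<And>x. x \<in> N \<Longrightarrow> (snd d \<circ> chart_inv c) x = x + v"
    using toric_transition_translation[OF assms] by metis
  have "((\<lambda>x. x + v) has_derivative (\<lambda>u. u)) (at x0)" by (auto intro!: derivative_eq_intros)
  then show ?thesis by (rule has_derivative_transform_within_open[OF _ N(1,2)]) (simp only: N(3))
qed

lemma toric_space_covered:
  fixes p :: "'n::finite toric_point"
  assumes R: "root_system R" and irr: "irreducible_root_system R" and PR: "P \<subseteq> R"
    and p: "p \<in> toric_space R P"
  obtains c where "c \<in> toric_atlas R P" "p \<in> fst c"
proof -
  have fin: "finite R" using R by (simp add: root_system_def)
  have p0: "p \<in> torus R \<times> (UNIV - {0})" using p toric_space_subset by blast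
  obtain W where W: "open W" "0 \<in> W"
    "\<And>x y. toric_param R p x = toric_param R p y \<Longrightarrow> x - y \<in> W \<Longrightarrow> x = y"
    using toric_param_locally_injective[OF R irr p0] by blast
  obtain e where e: "e > 0" "ball 0 e \<subseteq> W" using W by (meson open_contains_ball)
  \<comment> \<open>The ball of radius \<open>e/2\<close> gives injectivity, its differences lying
    in \<open>W\<close>; the finitely many open conditions keep the image off the hypertori.\<close>
  define U where "U = ball 0 (e/2) \<inter> (\<Inter>\<alpha>\<in>P. {x. fst (toric_param R p x) \<alpha> \<noteq> 1})"
  have "open {x. fst (toric_param R p x) \<alpha> \<noteq> 1}" for \<alpha>
    by (intro open_Collect_neq continuous_on_product_then_coordinatewise[OF continuous_on_fst[OF continuous_on_toric_param]] continuous_intros)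
  then have U: "open U" unfolding U_def using fin PR by (intro open_Int open_INT) (auto intro: finite_subset)
  have "inj_on (toric_param R p) U"
  proof (rule inj_onI, rule W(3))
    fix x y assume "x \<in> U" "y \<in> U"
    then have "norm (x - y) < e" using norm_triangle_ineq4[of x y] by (auto simp: U_def)
    then show "x - y \<in> W" using e by auto
  qed
  moreover have "toric_param R p ` U \<subseteq> toric_space R P"
  proof
    fix q assume "q \<in> toric_param R p ` U"
    then obtain x where "q = toric_param R p x" "x \<in> U" by blast
    then show "q \<in> toric_space R P"
      using toric_param_in[OF p0, of x] by (auto simp: U_def toric_space_def torus_regular_def)
  qed
  ultimately have "(toric_param R p ` U, inv_into U (toric_param R p)) \<in> toric_atlas R P"
    using U p unfolding toric_atlas_def by blast
  moreover have "p \<in> toric_param R p ` U"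
  proof (rule image_eqI[where x = 0])
    show "p = toric_param R p 0" using toric_param_zero[OF p0] by simp
    then show "0 \<in> U" using e p by (auto simp: U_def toric_space_def torus_regular_def)
  qed
  ultimately show thesis by (intro that[of "(toric_param R p ` U, inv_into U (toric_param R p))"]) simp_all
qed

proposition complex_manifold_toric_space:
  fixes R P :: "'n::finite covector set"
  assumes R: "root_system R" and irr: "irreducible_root_system R" and PR: "P \<subseteq> R"
  shows "complex_manifold (top_of_set (toric_space R P)) (toric_atlas R P)"
  unfolding complex_manifold_def second_countable_def[symmetric]
proof (intro conjI ballI)
  have fin: "finite R" using R by (simp add: root_system_def)
  \<comment> \<open>Separation and second countability are topological invariants and are
    transported from the space of sequences.\<close>
  obtain S' :: "((nat \<Rightarrow> complex) \<times> complex) set"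
    where hom: "top_of_set (toric_space R P) homeomorphic_space top_of_set S'"
    using torus_homeomorphic_sequences[OF fin, of "toric_space R P"] toric_space_subset[of R P] by blast
  have "Hausdorff_space (top_of_set S')"
    by (intro Hausdorff_space_subtopology) simp
  then show "Hausdorff_space (top_of_set (toric_space R P))"
    using homeomorphic_Hausdorff_space[OF hom] by simp
  have "second_countable (euclidean :: ((nat \<Rightarrow> complex) \<times> complex) topology)"
  proof -
    obtain B :: "((nat \<Rightarrow> complex) \<times> complex) set set" where B: "countable B" "\<And>C. C \<in> B \<Longrightarrow> open C"
      "\<And>S. open S \<Longrightarrow> \<exists>U. U \<subseteq> B \<and> S = \<Union>U"
      by (rule univ_second_countable) blast
    show ?thesis unfolding second_countable_def open_openin[symmetric]
    proof (intro exI[of _ B] conjI ballI allI impI)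
      fix U x assume "open U \<and> x \<in> (U :: ((nat \<Rightarrow> complex) \<times> complex) set)"
      then obtain V where "V \<subseteq> B" "U = \<Union>V" "x \<in> U" using B(3) by blast
      then show "\<exists>V\<in>B. x \<in> V \<and> V \<subseteq> U" by blast
    qed (use B in auto)
  qed
  then have "second_countable (top_of_set S')" by (rule second_countable_subtopology)
  then show "second_countable (top_of_set (toric_space R P))"
    using homeomorphic_space_second_countability[OF hom] by simp
  have sub: "fst c \<subseteq> toric_space R P" if "c \<in> toric_atlas R P" for c
    by (rule toric_chartE[OF that]) simp
  show "(\<Union>c\<in>toric_atlas R P. fst c) = topspace (top_of_set (toric_space R P))"
    unfolding topspace_euclidean_subtopology
  proof (intro equalityI UN_least sub subsetI)
    fix p assume "p \<in> toric_space R P"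
    then obtain c where "c \<in> toric_atlas R P" "p \<in> fst c" by (rule toric_space_covered[OF R irr PR])
    then show "p \<in> (\<Union>c\<in>toric_atlas R P. fst c)" by blast
  qed
  fix c assume c: "c \<in> toric_atlas R P"
  obtain p U where p: "p \<in> torus R \<times> (UNIV - {0})" "open U" "inj_on (toric_param R p) U"
    "toric_param R p ` U \<subseteq> toric_space R P" "fst c = toric_param R p ` U" "chart_image c = U"
    "\<forall>x\<in>U. chart_inv c x = toric_param R p x" "\<forall>x\<in>U. snd c (toric_param R p x) = x"
    by (rule toric_chartE[OF c]) (rule that)
  show "openin (top_of_set (toric_space R P)) (fst c)"
    unfolding p(5) by (rule openin_toric_space_param_image[OF R irr p(1,2,4)])
  show "open (chart_image c)" using p by simp
  have "homeomorphic_map (top_of_set U) (top_of_set (toric_param R p ` U)) (toric_param R p)"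
  proof (rule bijective_open_imp_homeomorphic_map)
    show "continuous_map (top_of_set U) (top_of_set (toric_param R p ` U)) (toric_param R p)"
      by (simp add: continuous_map_in_subtopology continuous_on_toric_param)
    show "open_map (top_of_set U) (top_of_set (toric_param R p ` U)) (toric_param R p)"
      unfolding open_map_def
    proof (intro allI impI)
      fix V assume "openin (top_of_set U) V"
      then have V: "open V" "V \<subseteq> U" using p(2) by (auto intro: openin_open_trans dest: openin_imp_subset)
      then have "toric_param R p ` V \<subseteq> toric_space R P" using p(4) by blast
      then have "openin (top_of_set (toric_space R P)) (toric_param R p ` V)"
        by (rule openin_toric_space_param_image[OF R irr p(1) V(1)])
      then show "openin (top_of_set (toric_param R p ` U)) (toric_param R p ` V)"
        by (rule openin_subset_trans) (use V p(4) in auto)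
    qed
  qed (use p(3) in auto)
  then obtain g where g: "homeomorphic_maps (top_of_set U) (top_of_set (toric_param R p ` U)) (toric_param R p) g"
    by (auto simp: homeomorphic_map_maps)
  \<comment> \<open>The inverse \<open>g\<close> and the chart map are compared on the chart domain
    only, which suffices for a homeomorphism of subspaces.\<close>
  have "homeomorphic_map (top_of_set (fst c)) (top_of_set (chart_image c)) (snd c)"
  proof (rule homeomorphic_map_eq)
    show "homeomorphic_map (top_of_set (fst c)) (top_of_set (chart_image c)) g"
      using g by (auto simp: homeomorphic_maps_map p(5,6))
    fix q assume "q \<in> topspace (top_of_set (fst c))"
    then obtain x where "x \<in> U" "q = toric_param R p x" by (auto simp: p(5))
    then show "g q = snd c q" using g p(8) by (auto simp: homeomorphic_maps_def)
  qed
  moreover have "subtopology (top_of_set (toric_space R P)) (fst c) = top_of_set (fst c)"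
    using sub[OF c] by (simp add: subtopology_subtopology inf_absorb2)
  ultimately show "homeomorphic_map (subtopology (top_of_set (toric_space R P)) (fst c)) (top_of_set (chart_image c)) (snd c)"
    by simp
  fix d assume d: "d \<in> toric_atlas R P"
  show "holomorphic_map_on (snd c ` (fst c \<inter> fst d)) (snd d \<circ> chart_inv c)"
    unfolding holomorphic_map_on_def holomorphic_fun_on_def
  proof (intro allI ballI exI conjI)
    fix i x assume "x \<in> snd c ` (fst c \<inter> fst d)"
    from bounded_linear.has_derivative[OF bounded_linear_vec_nth toric_transition_has_derivative[OF R irr c d this]]
    show "((\<lambda>x. (snd d \<circ> chart_inv c) x $ i) has_derivative (\<lambda>u. u $ i)) (at x)" .
    show "complex_linear_form (\<lambda>u :: complex^('n option). u $ i)" by (simp add: complex_linear_form_iff)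
  qed
qed

section \<open>The Frobenius structure\<close>

lemma complex_bilinear_form_bounded_bilinear:
  fixes g :: "complex^'m \<Rightarrow> complex^'m \<Rightarrow> complex"
  assumes "complex_bilinear_form g"
  shows "bounded_bilinear g"
  using assms
  by (auto simp: bilinear_conv_bounded_bilinear[symmetric] bilinear_def complex_bilinear_form_def
      intro: bounded_linear.linear complex_linear_form_bounded_linear)

text \<open>With Christoffel map 0, compatibility with a constant form is the product rule, and
  vanishing torsion is the coordinate formula for the bracket.\<close>

lemma levi_civita_on_constant_form:
  fixes g :: "complex^'m \<Rightarrow> complex^'m \<Rightarrow> complex"
  assumes g: "complex_bilinear_form g"
  shows "levi_civita_on \<Omega> (\<lambda>x. g) (\<lambda>x u v. 0)"
  unfolding levi_civita_on_def
proof (intro conjI ballI allI impI)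
  show "complex_bilinear_map (\<lambda>u v. 0 :: complex^'m)"
    by (simp add: complex_bilinear_map_def clinear_map_iff)
  show "holomorphic_map_on \<Omega> (\<lambda>x. 0 :: complex^'m)" by (rule holomorphic_map_on_const)
  fix V and X Y Z :: "complex^'m \<Rightarrow> complex^'m" and x
  assume *: "open V \<and> V \<subseteq> \<Omega> \<and> holomorphic_map_on V X \<and> holomorphic_map_on V Y \<and> holomorphic_map_on V Z"
    and x: "x \<in> V"
  show "covariant_derivative (\<lambda>x u v. 0) X Y x - covariant_derivative (\<lambda>x u v. 0) Y X x = lie_bracket X Y x"
    by (simp add: covariant_derivative_def lie_bracket_def)
  have "((\<lambda>y. g (Y y) (Z y)) has_derivative
      (\<lambda>u. g (Y x) (frechet_derivative Z (at x) u) + g (frechet_derivative Y (at x) u) (Z x))) (at x)"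
    using * x by (intro bounded_bilinear.FDERIV[OF complex_bilinear_form_bounded_bilinear[OF g]] holomorphic_map_on_frechet(1)[of V]) auto
  from frechet_derivative_at[OF this]
  have "frechet_derivative (\<lambda>y. g (Y y) (Z y)) (at x) =
    (\<lambda>u. g (Y x) (frechet_derivative Z (at x) u) + g (frechet_derivative Y (at x) u) (Z x))" by (rule sym)
  then show "frechet_derivative (\<lambda>y. g (Y y) (Z y)) (at x) (X x) =
     g (covariant_derivative (\<lambda>x u v. 0) X Y x) (Z x) + g (Y x) (covariant_derivative (\<lambda>x u v. 0) X Z x)"
    by (simp add: covariant_derivative_def)
qed

text \<open>The converse extraction: constant fields have vanishing derivatives and brackets, so
  only the two parts of the curvature remain. The bracket still enters as the direction 0, which the
  hypothesis \<open>zero\<close> disposes of.\<close>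

lemma flat_connection_on_constant_fields:
  fixes B :: "complex^'m \<Rightarrow> complex^'m \<Rightarrow> complex^'m \<Rightarrow> complex^'m"
  assumes flat: "flat_connection_on \<Omega> B" and \<Omega>: "open \<Omega>" and x: "x \<in> \<Omega>" and zero: "B x 0 w = 0"
  shows "frechet_derivative (\<lambda>y. B y v w) (at x) u + B x u (B x v w) =
         frechet_derivative (\<lambda>y. B y u w) (at x) v + B x v (B x u w)"
proof -
  have "covariant_derivative B (\<lambda>_. u) (covariant_derivative B (\<lambda>_. v) (\<lambda>_. w)) x
              - covariant_derivative B (\<lambda>_. v) (covariant_derivative B (\<lambda>_. u) (\<lambda>_. w)) x
              - covariant_derivative B (lie_bracket (\<lambda>_. u) (\<lambda>_. v)) (\<lambda>_. w) x = 0"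
    using flat \<Omega> x holomorphic_map_on_const unfolding flat_connection_on_def by blast
  then show ?thesis
    by (simp add: covariant_derivative_def[abs_def] lie_bracket_def zero)
qed

section \<open>The toric product, its trace form and its derivative\<close>

text \<open>The weights are left free because the product and its derivative in the base point have
  this same shape.\<close>

definition root_product ::
  "'n::finite covector set \<Rightarrow> ('n covector \<Rightarrow> complex) \<Rightarrow> complex^'n \<Rightarrow> complex^'n \<Rightarrow> complex^'n" where
  "root_product P w X Y = (1 / 2) *s (\<Sum>\<alpha>\<in>P. (w \<alpha> * cform \<alpha> X * cform \<alpha> Y) *s cvec (coroot \<alpha>))"

lemma root_product_add: "root_product P w X (Y + Y') = root_product P w X Y + root_product P w X Y'"
  and root_product_smult: "root_product P w X (c *s Y) = c *s root_product P w X Y"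
  by (simp_all add: root_product_def vec_eq_iff sum_component cform_add cform_smult sum.distrib sum_distrib_left algebra_simps)

lemma root_product_commute: "root_product P w X Y = root_product P w Y X"
  by (simp add: root_product_def mult_ac)

lemma h_part_toric_mult:
  "h_part (toric_mult P k b a p u v) =
     root_product P (\<lambda>\<alpha>. k \<alpha> * ((1 + fst p \<alpha>) / (1 - fst p \<alpha>))) (h_part u) (h_part v)
     - b (h_part u) (h_part v) + t_part v *s h_part u + t_part u *s h_part v"
  and t_part_toric_mult:
  "t_part (toric_mult P k b a p u v) = - a (h_part u) (h_part v) + t_part u * t_part v"
  by (simp_all add: toric_mult_def Let_def h_part_join_ht t_part_join_ht root_product_def)

lemma complex_bilinear_mapD:
  assumes "complex_bilinear_map b"
  shows "b u (v + v') = b u v + b u v'" "b u (c *s v) = c *s b u v"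
    "b (u + u') v = b u v + b u' v" "b (c *s u) v = c *s b u v"
  using assms by (auto simp: complex_bilinear_map_def clinear_map_iff)

lemma complex_bilinear_formD:
  assumes "complex_bilinear_form a"
  shows "a u (v + v') = a u v + a u v'" "a u (c *s v) = c * a u v"
    "a (u + u') v = a u v + a u' v" "a (c *s u) v = c * a u v" "a 0 v = 0" "a u 0 = 0"
proof -
  show 1: "a u (v + v') = a u v + a u v'" "a u (c *s v) = c * a u v"
    "a (u + u') v = a u v + a u' v" "a (c *s u) v = c * a u v" for u v u' v' c
    using assms by (auto simp: complex_bilinear_form_def complex_linear_form_iff)
  show "a 0 v = 0" "a u 0 = 0" using 1(2)[of u 0 0] 1(4)[of 0 0 v] by simp_all
qed

lemma toric_mult_commute:
  assumes "\<And>u v. b u v = b v u" "\<And>u v. a u v = a v u"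
  shows "toric_mult P k b a p u v = toric_mult P k b a p v u"
  by (rule ht_eqI) (simp_all add: h_part_toric_mult t_part_toric_mult assms(1)[of "h_part u"] assms(2)[of "h_part u"]
    root_product_commute[of _ _ "h_part u"] mult.commute algebra_simps)

lemma complex_bilinear_map_toric_mult:
  assumes b: "complex_bilinear_map b" "\<And>u v. b u v = b v u"
    and a: "complex_bilinear_form a" "\<And>u v. a u v = a v u"
  shows "complex_bilinear_map (toric_mult P k b a p)"
proof -
  have add: "toric_mult P k b a p u (v + v') = toric_mult P k b a p u v + toric_mult P k b a p u v'" for u v v'
    by (rule ht_eqI) (simp_all add: h_part_toric_mult t_part_toric_mult h_part_add t_part_add
      complex_bilinear_mapD[OF b(1)] complex_bilinear_formD[OF a(1)] root_product_add vec_eq_iff algebra_simps)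
  have smult: "toric_mult P k b a p u (c *s v) = c *s toric_mult P k b a p u v" for u v c
    by (rule ht_eqI) (simp_all add: h_part_toric_mult t_part_toric_mult h_part_smult t_part_smult
      complex_bilinear_mapD[OF b(1)] complex_bilinear_formD[OF a(1)] root_product_smult vec_eq_iff algebra_simps)
  note comm = toric_mult_commute[of b a, OF b(2) a(2)]
  have "toric_mult P k b a p (u + u') v = toric_mult P k b a p u v + toric_mult P k b a p u' v"
    "toric_mult P k b a p (c *s u) v = c *s toric_mult P k b a p u v" for u u' v c
    by (simp_all only: comm[of P k p _ v] add smult)
  with add smult show ?thesis by (simp add: complex_bilinear_map_def clinear_map_iff)
qed

lemma complex_bilinear_form_toric_form:
  assumes "complex_bilinear_form a"
  shows "complex_bilinear_form (toric_form a)"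
  unfolding complex_bilinear_form_def complex_linear_form_iff toric_form_def
  by (simp add: h_part_add t_part_add h_part_smult t_part_smult complex_bilinear_formD[OF assms] algebra_simps)

lemma toric_form_eq_trace:
  assumes "complex_bilinear_form a"
  shows "toric_form a (toric_mult P k b a p u v) toric_unit = toric_form a u v"
  by (simp add: toric_form_def toric_unit_def h_part_join_ht t_part_join_ht t_part_toric_mult
      complex_bilinear_formD[OF assms])

lemma toric_mult_unit:
  assumes b: "complex_bilinear_map b" and a: "complex_bilinear_form a"
  shows "toric_mult P k b a p toric_unit v = v"
proof (rule ht_eqI)
  have "b 0 (h_part v) = 0" using complex_bilinear_mapD(4)[OF b, of 0 0 "h_part v"] by simp
  moreover have "root_product P w 0 Y = 0" for w Y by (simp add: root_product_def cform_zero)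
  ultimately show "h_part (toric_mult P k b a p toric_unit v) = h_part v"
    by (simp add: h_part_toric_mult toric_unit_def h_part_join_ht t_part_join_ht)
  show "t_part (toric_mult P k b a p toric_unit v) = t_part v"
    by (simp add: t_part_toric_mult toric_unit_def h_part_join_ht t_part_join_ht complex_bilinear_formD[OF a])
qed

lemma toric_form_nondegenerate:
  assumes a: "\<And>u v. a u v = c * cdot u v" "c \<noteq> 0" and u: "\<And>v. toric_form a u v = 0"
  shows "u = 0"
proof (rule ht_eqI)
  have "h_part u $ i = 0" for i
    using u[of "join_ht (axis i 1) 0"] a(2)
    by (simp add: toric_form_def h_part_join_ht t_part_join_ht a(1) cdot_axis)
  then show "h_part u = h_part 0" by (simp add: vec_eq_iff h_part_zero)
  show "t_part u = t_part 0"
    using u[of "join_ht 0 1"] by (simp add: toric_form_def h_part_join_ht t_part_join_ht a(1) cdot_zero_right t_part_zero)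
qed

text \<open>For f = exp z up to a constant factor, (1 + f)/(1 - f) has the derivative 2f/(1 - f)^2;
  the chain rule contributes the factor \<alpha>(w).\<close>

lemma has_derivative_root_coefficient:
  assumes "\<alpha> \<in> root_lattice R" "fst (toric_param R p x) \<alpha> \<noteq> 1"
  shows "((\<lambda>y. (1 + fst (toric_param R p y) \<alpha>) / (1 - fst (toric_param R p y) \<alpha>)) has_derivative
     (\<lambda>w. 2 * fst (toric_param R p x) \<alpha> / (1 - fst (toric_param R p x) \<alpha>)\<^sup>2 * cform \<alpha> (h_part w))) (at x)"
proof -
  define g where "g y = fst p \<alpha> * exp (cform \<alpha> (h_part y))" for y
  have g: "fst (toric_param R p y) \<alpha> = g y" for y using assms(1) by (simp add: toric_param_def g_def)
  have 1: "((\<lambda>y. cform \<alpha> (h_part y)) has_derivative (\<lambda>w. cform \<alpha> (h_part w))) (at x)"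
    by (intro bounded_linear.has_derivative[OF bounded_linear_cform] bounded_linear.has_derivative[OF bounded_linear_h_part] has_derivative_ident)
  have "((\<lambda>z. (1 + fst p \<alpha> * exp z) / (1 - fst p \<alpha> * exp z)) has_field_derivative 2 * g x / (1 - g x)\<^sup>2) (at (cform \<alpha> (h_part x)))"
    using assms(2) unfolding g
    by (auto intro!: derivative_eq_intros simp: g_def power2_eq_square field_simps)
  from has_field_derivative_imp_has_derivative[OF this]
  have "((\<lambda>z. (1 + fst p \<alpha> * exp z) / (1 - fst p \<alpha> * exp z)) has_derivative (\<lambda>h. 2 * g x / (1 - g x)\<^sup>2 * h)) (at (cform \<alpha> (h_part x)))" .
  from diff_chain_at[OF 1 this] show ?thesis unfolding g by (simp add: o_def g_def)
qed

text \<open>The direction \<open>w\<close> is absorbed into the weight, which exhibits symmetry in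
  all three arguments. The last component is 0 because that of the product does not vary with the
  point.\<close>

definition toric_mult_derivative ::
  "'n::finite covector set \<Rightarrow> ('n covector \<Rightarrow> complex) \<Rightarrow> 'n toric_point \<Rightarrow>
   complex^('n option) \<Rightarrow> complex^('n option) \<Rightarrow> complex^('n option) \<Rightarrow> complex^('n option)" where
  "toric_mult_derivative P k p u v w = join_ht
     (root_product P (\<lambda>\<alpha>. k \<alpha> * (2 * fst p \<alpha> / (1 - fst p \<alpha>)\<^sup>2) * cform \<alpha> (h_part w)) (h_part u) (h_part v)) 0"

lemma has_derivative_toric_mult:
  assumes PR: "P \<subseteq> root_lattice R" and P: "\<And>\<alpha>. \<alpha> \<in> P \<Longrightarrow> fst (toric_param R p x) \<alpha> \<noteq> 1"
  shows "((\<lambda>y. toric_mult P k b a (toric_param R p y) u v) has_derivative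
     toric_mult_derivative P k (toric_param R p x) u v) (at x)"
  unfolding has_derivative_vec_iff
proof
  fix i
  show "((\<lambda>y. toric_mult P k b a (toric_param R p y) u v $ i) has_derivative
       (\<lambda>w. toric_mult_derivative P k (toric_param R p x) u v w $ i)) (at x)"
  proof (cases i)
    case None
    then show ?thesis by (simp add: toric_mult_def toric_mult_derivative_def Let_def join_ht_def)
  next
    case (Some j)
    define C where "C = (- b (h_part u) (h_part v) + t_part v *s h_part u + t_part u *s h_part v) $ j"
    define D where "D w = (1/2) * (\<Sum>\<alpha>\<in>P. (k \<alpha> * (2 * fst (toric_param R p x) \<alpha> / (1 - fst (toric_param R p x) \<alpha>)\<^sup>2 * cform \<alpha> (h_part w))
        * cform \<alpha> (h_part u) * cform \<alpha> (h_part v)) * cvec (coroot \<alpha>) $ j)" for w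
    have "((\<lambda>y. (1/2) * (\<Sum>\<alpha>\<in>P. (k \<alpha> * ((1 + fst (toric_param R p y) \<alpha>) / (1 - fst (toric_param R p y) \<alpha>))
        * cform \<alpha> (h_part u) * cform \<alpha> (h_part v)) * cvec (coroot \<alpha>) $ j) + C) has_derivative (\<lambda>w. D w + 0)) (at x)"
      unfolding D_def
      by (intro has_derivative_add has_derivative_mult_right has_derivative_mult_left has_derivative_sum
         has_derivative_root_coefficient has_derivative_const) (use PR P in auto)
    moreover have "(\<lambda>w. D w + 0) = (\<lambda>w. toric_mult_derivative P k (toric_param R p x) u v w $ i)"
      by (simp add: D_def toric_mult_derivative_def join_ht_def Some root_product_def sum_component mult_ac)
    moreover have "toric_mult P k b a (toric_param R p y) u v $ i =
       (1/2) * (\<Sum>\<alpha>\<in>P. (k \<alpha> * ((1 + fst (toric_param R p y) \<alpha>) / (1 - fst (toric_param R p y) \<alpha>))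
        * cform \<alpha> (h_part u) * cform \<alpha> (h_part v)) * cvec (coroot \<alpha>) $ j) + C" for y
      by (simp add: toric_mult_def Let_def join_ht_def Some C_def sum_component algebra_simps)
    ultimately show ?thesis by simp
  qed
qed

lemma clinear_toric_mult_derivative:
  "Vector_Spaces.linear (*s) (*s) (toric_mult_derivative P k p u v)"
proof -
  \<comment> \<open>Symmetry puts \<open>w\<close> into a slot in which \<open>root_product\<close>
    is already known to be linear.\<close>
  have eq: "toric_mult_derivative P k p u v w = join_ht
     (root_product P (\<lambda>\<alpha>. k \<alpha> * (2 * fst p \<alpha> / (1 - fst p \<alpha>)\<^sup>2) * cform \<alpha> (h_part u)) (h_part v) (h_part w)) 0" for w
    by (simp add: toric_mult_derivative_def root_product_def mult_ac)
  have "toric_mult_derivative P k p u v (x + y) = toric_mult_derivative P k p u v x + toric_mult_derivative P k p u v y" for x y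
    by (rule ht_eqI) (simp_all only: eq h_part_join_ht t_part_join_ht h_part_add t_part_add root_product_add add_0)
  moreover have "toric_mult_derivative P k p u v (c *s x) = c *s toric_mult_derivative P k p u v x" for c x
    by (rule ht_eqI) (simp_all only: eq h_part_join_ht t_part_join_ht h_part_smult t_part_smult root_product_smult mult_zero_right)
  ultimately show ?thesis by (simp add: clinear_map_iff)
qed

lemma toric_mult_derivative_commute:
  "toric_mult_derivative P k p u v w = toric_mult_derivative P k p w v u"
  by (simp add: toric_mult_derivative_def root_product_def mult_ac)

section \<open>The Frobenius structure in one chart, and the global result\<close>

proposition frobenius_structure_toric_chart:
  fixes R P :: "'n::finite covector set"
  assumes R: "root_system R" and irr: "irreducible_root_system R" and PR: "P \<subseteq> R"
    and b: "complex_bilinear_map b" "\<And>u v. b u v = b v u"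
    and a: "complex_bilinear_form a" "\<And>u v. a u v = a v u" "\<And>u v. a u v = z * cdot u v" "z \<noteq> 0"
    and c: "c \<in> toric_atlas R P"
    and flat: "flat_connection_on (chart_image c) (\<lambda>x. toric_mult P k b a (chart_inv c x))"
  shows "frobenius_structure_on (chart_image c) (\<lambda>x. toric_mult P k b a (chart_inv c x)) (\<lambda>x. toric_form a) (\<lambda>x. toric_unit)"
proof -
  obtain p U where p: "p \<in> torus R \<times> (UNIV - {0})" "open U" "inj_on (toric_param R p) U"
    "toric_param R p ` U \<subseteq> toric_space R P" "fst c = toric_param R p ` U" "chart_image c = U"
    "\<forall>x\<in>U. chart_inv c x = toric_param R p x" "\<forall>x\<in>U. snd c (toric_param R p x) = x"
    by (rule toric_chartE[OF c]) (rule that)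
  define M where "M x = toric_mult P k b a (chart_inv c x)" for x
  have PL: "P \<subseteq> root_lattice R" using PR root_in_root_lattice R by (auto simp: root_system_def)
  have bilM: "complex_bilinear_map (M x)" for x
    unfolding M_def by (rule complex_bilinear_map_toric_mult[OF b a(1,2)])
  have commM: "M x u v = M x v u" for x u v
    unfolding M_def by (rule toric_mult_commute[OF b(2) a(2)])
  have derM: "((\<lambda>y. M y u v) has_derivative toric_mult_derivative P k (toric_param R p x) u v) (at x)"
    if x: "x \<in> U" for x u v
  proof (rule has_derivative_transform_within_open[OF has_derivative_toric_mult[OF PL] p(2) x])
    show "fst (toric_param R p x) \<alpha> \<noteq> 1" if "\<alpha> \<in> P" for \<alpha>
      using p(4) x that by (auto simp: toric_space_def torus_regular_def)
    show "toric_mult P k b a (toric_param R p y) u v = M y u v" if "y \<in> U" for y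
      using p(7) that by (simp add: M_def)
  qed
  have holM: "holomorphic_map_on U (\<lambda>x. M x u v)" for u v
    unfolding holomorphic_map_on_def holomorphic_fun_on_def
  proof (intro allI ballI exI conjI)
    fix i x assume x: "x \<in> U"
    show "((\<lambda>x. M x u v $ i) has_derivative (\<lambda>w. toric_mult_derivative P k (toric_param R p x) u v w $ i)) (at x)"
      using derM[OF x] by (simp add: has_derivative_vec_iff)
    show "complex_linear_form (\<lambda>w. toric_mult_derivative P k (toric_param R p x) u v w $ i)"
      using clinear_toric_mult_derivative[of P k "toric_param R p x" u v] by (simp add: clinear_map_nth_iff)
  qed
  have fd: "frechet_derivative (\<lambda>y. M y u v) (at x) = toric_mult_derivative P k (toric_param R p x) u v" if "x \<in> U" for x u v
    using frechet_derivative_at[OF derM[OF that]] by simp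
  have closedM: "frechet_derivative (\<lambda>y. M y v w) (at x) u = frechet_derivative (\<lambda>y. M y u w) (at x) v"
    if "x \<in> U" for x u v w
    unfolding fd[OF that] by (rule toric_mult_derivative_commute)
  \<comment> \<open>Flatness on constant fields equates two sums of a derivative term and a product
    term; by \<open>closedM\<close> the derivative terms agree.\<close>
  have comm2: "M x u (M x v w) = M x v (M x u w)" if "x \<in> U" for x u v w
  proof -
    have "M x 0 w = 0" using complex_bilinear_mapD(4)[OF bilM, of x 0 0 w] by simp
    then have "frechet_derivative (\<lambda>y. M y v w) (at x) u + M x u (M x v w) =
      frechet_derivative (\<lambda>y. M y u w) (at x) v + M x v (M x u w)"
      using flat p(2) that unfolding p(6) M_def[symmetric] by (intro flat_connection_on_constant_fields) auto
    then show ?thesis using closedM[OF that, of v w u] by simp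
  qed
  \<comment> \<open>For a commutative product, associativity says exactly that multiplication
    operators commute.\<close>
  have assoc: "M x (M x u v) w = M x u (M x v w)" if "x \<in> U" for x u v w
    using comm2[OF that, of w u v] by (simp add: commM[of x "M x u v" w] commM[of x w v])
  \<comment> \<open>The summand 0 is the Christoffel map of the Levi-Civita connection, kept so that
    the pencil has the form prescribed by the definition.\<close>
  have flat_mu: "flat_connection_on U (\<lambda>x u v. 0 + \<mu> *s M x u v)" for \<mu>
  proof (rule flat_connection_onI[OF p(2)])
    show "complex_bilinear_map (\<lambda>u v. 0 + \<mu> *s M x u v)" for x
      unfolding complex_bilinear_map_def clinear_map_iff
      by (auto simp: complex_bilinear_mapD[OF bilM] vec_eq_iff algebra_simps)
    have der: "((\<lambda>y. 0 + \<mu> *s M y u v) has_derivative (\<lambda>w. \<mu> *s toric_mult_derivative P k (toric_param R p x) u v w)) (at x)"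
      if "x \<in> U" for x u v
      using bounded_linear.has_derivative[OF bounded_bilinear.bounded_linear_right[OF bounded_bilinear_smult_vec] derM[OF that], of \<mu>]
      by simp
    show "holomorphic_map_on U (\<lambda>x. 0 + \<mu> *s M x u v)" for u v
      unfolding holomorphic_map_on_def holomorphic_fun_on_def
    proof (intro allI ballI exI conjI)
      fix i x assume x: "x \<in> U"
      show "((\<lambda>x. (0 + \<mu> *s M x u v) $ i) has_derivative (\<lambda>w. (\<mu> *s toric_mult_derivative P k (toric_param R p x) u v w) $ i)) (at x)"
        using der[OF x] unfolding has_derivative_vec_iff by blast
      show "complex_linear_form (\<lambda>w. (\<mu> *s toric_mult_derivative P k (toric_param R p x) u v w) $ i)"
        using clinear_toric_mult_derivative[of P k "toric_param R p x" u v]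
        by (auto simp: clinear_map_nth_iff complex_linear_form_iff algebra_simps)
    qed
    show "frechet_derivative (\<lambda>y. 0 + \<mu> *s M y v w) (at x) u = frechet_derivative (\<lambda>y. 0 + \<mu> *s M y u w) (at x) v"
      if "x \<in> U" for x u v w
      unfolding frechet_derivative_at[OF der[OF that], symmetric]
      by (simp only: toric_mult_derivative_commute[of _ _ _ v w u])
    show "0 + \<mu> *s M x u (0 + \<mu> *s M x v w) = 0 + \<mu> *s M x v (0 + \<mu> *s M x u w)" if "x \<in> U" for x u v w
      using comm2[OF that, of u v w] by (simp add: complex_bilinear_mapD[OF bilM])
  qed
  have frob: "frobenius_algebra (M x) (\<lambda>u. toric_form a u toric_unit) toric_unit" if "x \<in> U" for x
    unfolding frobenius_algebra_def
  proof (intro conjI allI impI)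
    show "complex_linear_form (\<lambda>u. toric_form a u toric_unit)"
      using complex_bilinear_form_toric_form[OF a(1)] by (simp add: complex_bilinear_form_def)
    show "M x toric_unit u = u" for u unfolding M_def by (rule toric_mult_unit[OF b(1) a(1)])
    show "u = 0" if "\<forall>v. toric_form a (M x u v) toric_unit = 0" for u
      using that unfolding M_def toric_form_eq_trace[OF a(1)]
      by (intro toric_form_nondegenerate[OF a(3,4)]) auto
  qed (fact bilM commM assoc[OF that])+
  have LC: "levi_civita_on U (\<lambda>x. toric_form a) (\<lambda>x u v. 0)"
    by (rule levi_civita_on_constant_form[OF complex_bilinear_form_toric_form[OF a(1)]])
  have trace: "toric_form a u v = toric_form a (M x u v) toric_unit" for x u v
    unfolding M_def toric_form_eq_trace[OF a(1)] ..
  show ?thesis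
    unfolding frobenius_structure_on_def p(6) M_def[symmetric]
  proof (intro conjI ballI allI exI[of _ "\<lambda>x u v. 0"] impI)
    show "covariant_derivative (\<lambda>x u v. 0) X (\<lambda>x. toric_unit) x = 0" for X :: "complex^('n option) \<Rightarrow> complex^('n option)" and x
      by (simp add: covariant_derivative_def)
  qed (fact frob trace holM holomorphic_fun_on_const holomorphic_map_on_const LC flat_mu | rule trace)+
qed

lemma b_kappa_bilinear: "complex_bilinear_map (b_kappa R \<phi> k')"
  and b_kappa_commute: "b_kappa R \<phi> k' u v = b_kappa R \<phi> k' v u"
proof -
  define I where "I = {(i, j). 1 \<le> i \<and> i < j \<and> j \<le> CARD('a) + 1}"
  have eq: "b_kappa R \<phi> k' u v = (if typeA R \<and> CARD('a) \<ge> 2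
      then (k' / 2) *s (\<Sum>q\<in>I. (cform (typeA_root \<phi> (fst q) (snd q)) u * cform (typeA_root \<phi> (fst q) (snd q)) v)
               *s cvec (typeA_prime \<phi> (fst q) (snd q))) else 0)" for u v :: "complex^'a"
    by (simp add: b_kappa_def I_def split_beta)
  show "complex_bilinear_map (b_kappa R \<phi> k')"
    unfolding complex_bilinear_map_def clinear_map_iff eq
    by (cases "typeA R \<and> CARD('a) \<ge> 2")
       (simp_all only: if_True if_False simp_thms, simp_all add: vec_eq_iff sum_component cform_add cform_smult sum.distrib sum_distrib_left algebra_simps)
  show "b_kappa R \<phi> k' u v = b_kappa R \<phi> k' v u"
    by (simp add: eq mult.commute)
qed

theorem corollary1p2:
  fixes R P :: "'n::finite covector set"
    and k :: "'n covector \<Rightarrow> complex"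
    and k' :: complex
    and \<phi> :: "real^'n \<Rightarrow> nat \<Rightarrow> real"
    and a :: "complex^'n \<Rightarrow> complex^'n \<Rightarrow> complex"
  assumes "root_system R" and "reduced_root_system R" and "irreducible_root_system R"
    and "positive_roots R P"
    and "weyl_invariant_multiplicity R k"
    and "typeA R \<Longrightarrow> typeA_realization R \<phi> \<and> typeA_positive P \<phi>"
    and "a_kappa_form R P k (b_kappa R \<phi> k') a"
    and "\<exists>u v. a u v \<noteq> 0"
  shows "frobenius_manifold (top_of_set (toric_space R P)) (toric_atlas R P)
           (\<lambda>c. toric_mult P k (b_kappa R \<phi> k') a)
           (\<lambda>c p. toric_form a)
           (\<lambda>c p. toric_unit)"
proof -
  note R = assms(1) and irr = assms(3)
  have PR: "P \<subseteq> R" using assms(4) by (auto simp: positive_roots_def)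
  have a: "complex_bilinear_form a" "\<And>u v. a u v = a v u"
    and inv: "\<And>w u v. w \<in> weyl_group R \<Longrightarrow> a (cmap w u) (cmap w v) = a u v"
    and flat: "\<And>c. c \<in> toric_atlas R P \<Longrightarrow>
       flat_connection_on (chart_image c) (\<lambda>x. toric_mult P k (b_kappa R \<phi> k') a (chart_inv c x))"
    using assms(7) unfolding a_kappa_form_def toric_connection_flat_def by blast+
  \<comment> \<open>Reflections are words of length one in the Weyl group, so Weyl invariance gives
    the reflection invariance that determines \<open>a\<close> up to the scalar
    \<open>z\<close>.\<close>
  have "reflection \<alpha> \<in> weyl_group R" if "\<alpha> \<in> R" for \<alpha>
    using weyl_reflection[OF that weyl_id] by simp
  then obtain z where z: "\<And>u v. a u v = z * cdot u v"
    using reflection_invariant_form_scalar[OF R irr a] inv by metis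
  then have z0: "z \<noteq> 0" using assms(8) by auto
  show ?thesis
    unfolding frobenius_manifold_def Let_def
  proof (intro conjI ballI)
    show "complex_manifold (top_of_set (toric_space R P)) (toric_atlas R P)"
      by (rule complex_manifold_toric_space[OF R irr PR])
    show "frobenius_structure_on (chart_image c) (\<lambda>x. toric_mult P k (b_kappa R \<phi> k') a (chart_inv c x))
        (\<lambda>x. toric_form a) (\<lambda>x. toric_unit)" if "c \<in> toric_atlas R P" for c
      by (rule frobenius_structure_toric_chart[OF R irr PR b_kappa_bilinear b_kappa_commute a z z0 that flat[OF that]])
    fix c d p assume "c \<in> toric_atlas R P" "d \<in> toric_atlas R P" "p \<in> fst c \<inter> fst d"
    \<comment> \<open>With the identity as Jacobian, the three transformation rules reduce to
      equalities of identical expressions.\<close>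
    then have D: "frechet_derivative (snd d \<circ> chart_inv c) (at (snd c p)) = (\<lambda>u. u)"
      using frechet_derivative_at[OF toric_transition_has_derivative[OF R irr, of c P d "snd c p"]] by simp
    show "\<forall>u v. frechet_derivative (snd d \<circ> chart_inv c) (at (snd c p)) (toric_mult P k (b_kappa R \<phi> k') a p u v) =
        toric_mult P k (b_kappa R \<phi> k') a p (frechet_derivative (snd d \<circ> chart_inv c) (at (snd c p)) u)
          (frechet_derivative (snd d \<circ> chart_inv c) (at (snd c p)) v)"
      "\<forall>u v. toric_form a u v = toric_form a (frechet_derivative (snd d \<circ> chart_inv c) (at (snd c p)) u)
          (frechet_derivative (snd d \<circ> chart_inv c) (at (snd c p)) v)"
      "frechet_derivative (snd d \<circ> chart_inv c) (at (snd c p)) toric_unit = toric_unit"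
      by (simp_all add: D)
  qed
qed

end
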